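(* Deductions in $\mathbf{INF}$ can be brought into normal form: for every deduction in $\mathbf{INF}$ of a formula $A$ from a set $\Gamma$ of open assumptions there is a deduction in $\mathbf{INF}$ of $A$, all of whose open assumptions belong to $\Gamma$, which is in normal form.
   Context: **Language.** First-order language with parameters $a,b,\ldots$ (used as free variables, distinct in shape from the bound variables $x,y,z,\ldots$), constants, predicate letters, identity $=$, a one-place existence predicate $\exists!$, and $\bot,\land,\lor,\rightarrow,\exists,\forall$; $\neg A$ is $A\rightarrow\bot$. Terms are parameters and constants. $A_t^x$ is $A$ with $t$ replacing all free occurrences of $x$. Prime (here also: atomic) formulas are those formed by a predicate letter, $\exists!$ or $=$ from terms; $\bot$ is not prime. **Rules of $\mathbf{INF}$** (intuitionist negative free logic; natural deduction trees, $[A]$ marks a class of assumptions discharged by the rule, vacuous discharge allowed). $(\land I)$: from $A$, $B$ infer $A\land B$. $(\land E)$: from $A\land B$ infer $A$; from $A\land B$ infer $B$. $(\rightarrow I)$: from a deduction of $B$ from $[A]$ infer $A\rightarrow B$. $(\rightarrow E)$: from $A\rightarrow B$ and $A$ infer $B$. $(\lor I)$: from $A$ infer $A\lor B$; from $B$ infer $A\lor B$. $(\lor E)$: from $A\lor B$, a deduction of $C$ from $[A]$ and a deduction of $C$ from $[B]$ infer $C$. $(\bot E)$: from $\bot$ infer $B$. $(\forall I)$: from a deduction $\Pi$ of $A_a^x$ from $[\exists!a]$ infer $\forall xA$, where $a$ does not occur in $\forall xA$ nor in undischarged assumptions of $\Pi$ except those in the class of $\exists!a$. $(\forall E)$: from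 $\forall xA$ and $\exists!t$ infer $A_t^x$. $(\exists I)$: from $A_t^x$ and $\exists!t$ infer $\exists xA$. $(\exists E)$: from $\exists xA$ and a deduction $\Pi$ of $C$ from $[A_a^x],[\exists!a]$ infer $C$, where $a$ does not occur in $C$, in $\exists xA$, nor in undischarged assumptions of $\Pi$ except those in the classes of $A_a^x$ and $\exists!a$. $(=I^n)$: from $\exists!t$ infer $t=t$. $(=E)$: from $t_1=t_2$ and $A_{t_1}^x$ infer $A_{t_2}^x$. $(AD)$: from $Rt_1\ldots t_n$ infer $\exists!t_i$ ($1\le i\le n$), where $R$ is a predicate letter (not $\exists!$) or $=$. **Standing conventions.** Applications of $(=E)$ have atomic conclusions and applications of $(\bot E)$ have prime conclusions. Vacuous applications of $(=E)$ (major premise $t=t$) are assumed to be always removed. The major premise of an elimination rule is its leftmost premise in the list above, the other premises are minor. **Segments and normal form.** A *segment* is a sequence of formula occurrences $C_1,\ldots,C_n$ such that $C_1$ is not the conclusion of $(\lor E)$ or $(\exists E)$, $C_n$ is not a minor premise of $(\lor E)$ or $(\exists E)$, and for all $i<n$, $C_i$ is a minor premise of $(\lor E)$ or $(\exists E)$ with conclusion $C_{i+1}$; $n$ is its length. A segment is said to be a premise (conclusion) of a rule if its last (first) formula is. The following segments are maximal. (1) A segment whose last formula is the major premise of an elimination rule and which, if its length is $1$, is the conclusion of an introduction rule. (2) A *maximal $=$-segment*: a segment of formulas $t=t$ whose first formula is concluded by $(=I^n)$ and whose last is the premise of $(AD)$. (3) A *maximal $\exists!$-segment*: a segment of formulas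 $\exists!t$ whose first formula is concluded from $t=t$ by $(AD)$ and whose last is the premise of $(=I^n)$. (4) A *maximal $(=E)$-segment*: an $(=E)$-segment is a sequence of segments $\sigma_1,\ldots,\sigma_n$ where $\sigma_1$ is the minor premise but not the conclusion of $(=E)$, $\sigma_n$ is the conclusion but not the minor premise of $(=E)$, each $\sigma_i$ with $1<i<n$ is both, and $\sigma_{i+1}$ is concluded from minor premise $\sigma_i$; it is maximal if its last segment is the premise of $(AD)$ or if all formulas on it are of the form $\exists!t$. A deduction is in *normal form* if it contains no maximal segments of any of these kinds. *)

theory Defs
  imports Main
begin

text \<open>Terms are parameters and constants. Bound variables are not terms; they occur only as
  arguments of prime formulas. Since terms contain no bound variables, substitution of a term
  for a bound variable cannot capture.\<close>

datatype 'c trm = Par nat | Con 'c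

datatype 'c arg = Var nat | Tm "'c trm"

text \<open>\<open>Ext\<close> is the one-place existence predicate, which negative free logic writes \<open>\<exists>!\<close>.\<close>

datatype ('c, 'p) fm =
    Rel 'p "'c arg list"
  | Ext "'c arg"
  | Eq "'c arg" "'c arg"
  | Falsum
  | Conj "('c, 'p) fm" "('c, 'p) fm"
  | Disj "('c, 'p) fm" "('c, 'p) fm"
  | Impl "('c, 'p) fm" "('c, 'p) fm"
  | Exists nat "('c, 'p) fm"
  | Forall nat "('c, 'p) fm"

fun prime :: "('c, 'p) fm \<Rightarrow> bool" where
  "prime (Rel P ss) = True"
| "prime (Ext s) = True"
| "prime (Eq s s') = True"
| "prime _ = False"

primrec subst_arg :: "nat \<Rightarrow> 'c trm \<Rightarrow> 'c arg \<Rightarrow> 'c arg" where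
  "subst_arg x t (Var y) = (if y = x then Tm t else Var y)"
| "subst_arg x t (Tm s) = Tm s"

primrec subst :: "nat \<Rightarrow> 'c trm \<Rightarrow> ('c, 'p) fm \<Rightarrow> ('c, 'p) fm" where
  "subst x t (Rel P ss) = Rel P (map (subst_arg x t) ss)"
| "subst x t (Ext s) = Ext (subst_arg x t s)"
| "subst x t (Eq s s') = Eq (subst_arg x t s) (subst_arg x t s')"
| "subst x t Falsum = Falsum"
| "subst x t (Conj A B) = Conj (subst x t A) (subst x t B)"
| "subst x t (Disj A B) = Disj (subst x t A) (subst x t B)"
| "subst x t (Impl A B) = Impl (subst x t A) (subst x t B)"
| "subst x t (Exists y A) = Exists y (if y = x then A else subst x t A)"
| "subst x t (Forall y A) = Forall y (if y = x then A else subst x t A)"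

primrec vars_arg :: "'c arg \<Rightarrow> nat set" where
  "vars_arg (Var x) = {x}"
| "vars_arg (Tm t) = {}"

primrec free_vars :: "('c, 'p) fm \<Rightarrow> nat set" where
  "free_vars (Rel P ss) = (\<Union>s \<in> set ss. vars_arg s)"
| "free_vars (Ext s) = vars_arg s"
| "free_vars (Eq s s') = vars_arg s \<union> vars_arg s'"
| "free_vars Falsum = {}"
| "free_vars (Conj A B) = free_vars A \<union> free_vars B"
| "free_vars (Disj A B) = free_vars A \<union> free_vars B"
| "free_vars (Impl A B) = free_vars A \<union> free_vars B"
| "free_vars (Exists x A) = free_vars A - {x}"
| "free_vars (Forall x A) = free_vars A - {x}"

primrec params_arg :: "'c arg \<Rightarrow> nat set" where
  "params_arg (Var x) = {}"
| "params_arg (Tm t) = (case t of Par a \<Rightarrow> {a} | Con c \<Rightarrow> {})"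

primrec params :: "('c, 'p) fm \<Rightarrow> nat set" where
  "params (Rel P ss) = (\<Union>s \<in> set ss. params_arg s)"
| "params (Ext s) = params_arg s"
| "params (Eq s s') = params_arg s \<union> params_arg s'"
| "params Falsum = {}"
| "params (Conj A B) = params A \<union> params B"
| "params (Disj A B) = params A \<union> params B"
| "params (Impl A B) = params A \<union> params B"
| "params (Exists x A) = params A"
| "params (Forall x A) = params A"

primrec arity_ok :: "('p \<Rightarrow> nat) \<Rightarrow> ('c, 'p) fm \<Rightarrow> bool" where
  "arity_ok ar (Rel P ss) = (length ss = ar P)"
| "arity_ok ar (Ext s) = True"
| "arity_ok ar (Eq s s') = True"
| "arity_ok ar Falsum = True"
| "arity_ok ar (Conj A B) = (arity_ok ar A \<and> arity_ok ar B)"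
| "arity_ok ar (Disj A B) = (arity_ok ar A \<and> arity_ok ar B)"
| "arity_ok ar (Impl A B) = (arity_ok ar A \<and> arity_ok ar B)"
| "arity_ok ar (Exists x A) = arity_ok ar A"
| "arity_ok ar (Forall x A) = arity_ok ar A"

text \<open>Bound variables are not used as free variables, so the formulas proper are the
  elements of \<open>fm\<close> in which no bound variable is free.\<close>

definition formula :: "('p \<Rightarrow> nat) \<Rightarrow> ('c, 'p) fm \<Rightarrow> bool" where
  "formula ar A \<longleftrightarrow> arity_ok ar A \<and> free_vars A = {}"

text \<open>Each assumption carries a label, and an assumption class is given by a label and a formula.
  A discharging inference carries the label \<open>u\<close> of the classes it discharges, quantifier rules with
  an eigenparameter also that parameter \<open>a\<close>.\<close>

datatype rule =
    AndI | AndE | ImpI nat | ImpE | OrI | OrE nat | BotE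
  | AllI nat nat | AllE | ExI | ExE nat nat
  | EqI | EqE | AD

datatype ('c, 'p) ded =
    Assume nat "('c, 'p) fm"
  | Infer rule "('c, 'p) ded list" "('c, 'p) fm"

primrec concl :: "('c, 'p) ded \<Rightarrow> ('c, 'p) fm" where
  "concl (Assume u A) = A"
| "concl (Infer r Ds A) = A"

text \<open>The assumption classes discharged above the \<open>i\<close>-th premise (counted from 0) of an inference
  with premises \<open>Bs\<close> and conclusion \<open>C\<close>.\<close>

definition discharged ::
  "rule \<Rightarrow> ('c, 'p) fm list \<Rightarrow> ('c, 'p) fm \<Rightarrow> nat \<Rightarrow> (nat \<times> ('c, 'p) fm) set"
where
  "discharged r Bs C i =
     (case r of
        ImpI u \<Rightarrow> (case C of Impl A B \<Rightarrow> {(u, A)} | _ \<Rightarrow> {})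
      | OrE u \<Rightarrow>
          (case hd Bs of
             Disj A B \<Rightarrow> if i = 1 then {(u, A)} else if i = 2 then {(u, B)} else {}
           | _ \<Rightarrow> {})
      | AllI u a \<Rightarrow> {(u, Ext (Tm (Par a)))}
      | ExE u a \<Rightarrow>
          (case hd Bs of
             Exists x A \<Rightarrow>
               if i = 1 then {(u, subst x (Par a) A), (u, Ext (Tm (Par a)))} else {}
           | _ \<Rightarrow> {})
      | _ \<Rightarrow> {})"

primrec opens :: "('c, 'p) ded \<Rightarrow> (nat \<times> ('c, 'p) fm) set" where
  "opens (Assume u A) = {(u, A)}"
| "opens (Infer r Ds C) =
     (\<Union>i < length Ds. map opens Ds ! i - discharged r (map concl Ds) C i)"

text \<open>The conclusions of \<open>BotE\<close> and \<open>EqE\<close> are restricted to prime formulas, and vacuous applications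
  of \<open>EqE\<close> (major premise \<open>t = t\<close>) are excluded. The requirement that formulas be well formed
  is imposed only where it does not follow from the premises; see \<open>deduction_formula\<close>.\<close>

inductive deduction :: "('p \<Rightarrow> nat) \<Rightarrow> ('c, 'p) ded \<Rightarrow> bool" for ar where
  assm:
    "formula ar A \<Longrightarrow> deduction ar (Assume u A)"
| andI:
    "\<lbrakk>deduction ar D1; concl D1 = A; deduction ar D2; concl D2 = B\<rbrakk>
     \<Longrightarrow> deduction ar (Infer AndI [D1, D2] (Conj A B))"
| andE1:
    "\<lbrakk>deduction ar D; concl D = Conj A B\<rbrakk> \<Longrightarrow> deduction ar (Infer AndE [D] A)"
| andE2:
    "\<lbrakk>deduction ar D; concl D = Conj A B\<rbrakk> \<Longrightarrow> deduction ar (Infer AndE [D] B)"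
| impI:
    "\<lbrakk>deduction ar D; concl D = B; formula ar A\<rbrakk>
     \<Longrightarrow> deduction ar (Infer (ImpI u) [D] (Impl A B))"
| impE:
    "\<lbrakk>deduction ar D1; concl D1 = Impl A B; deduction ar D2; concl D2 = A\<rbrakk>
     \<Longrightarrow> deduction ar (Infer ImpE [D1, D2] B)"
| orI1:
    "\<lbrakk>deduction ar D; concl D = A; formula ar B\<rbrakk>
     \<Longrightarrow> deduction ar (Infer OrI [D] (Disj A B))"
| orI2:
    "\<lbrakk>deduction ar D; concl D = B; formula ar A\<rbrakk>
     \<Longrightarrow> deduction ar (Infer OrI [D] (Disj A B))"
| orE:
    "\<lbrakk>deduction ar D; concl D = Disj A B;
      deduction ar D1; concl D1 = C; deduction ar D2; concl D2 = C\<rbrakk>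
     \<Longrightarrow> deduction ar (Infer (OrE u) [D, D1, D2] C)"
| botE:
    "\<lbrakk>deduction ar D; concl D = Falsum; formula ar B; prime B\<rbrakk>
     \<Longrightarrow> deduction ar (Infer BotE [D] B)"
| allI:
    "\<lbrakk>deduction ar D; concl D = subst x (Par a) A;
      a \<notin> params (Forall x A);
      \<forall>(v, B) \<in> opens D - {(u, Ext (Tm (Par a)))}. a \<notin> params B\<rbrakk>
     \<Longrightarrow> deduction ar (Infer (AllI u a) [D] (Forall x A))"
| allE:
    "\<lbrakk>deduction ar D1; concl D1 = Forall x A; deduction ar D2; concl D2 = Ext (Tm t)\<rbrakk>
     \<Longrightarrow> deduction ar (Infer AllE [D1, D2] (subst x t A))"
| exI:
    "\<lbrakk>deduction ar D1; concl D1 = subst x t A; deduction ar D2; concl D2 = Ext (Tm t)\<rbrakk>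
     \<Longrightarrow> deduction ar (Infer ExI [D1, D2] (Exists x A))"
| exE:
    "\<lbrakk>deduction ar D1; concl D1 = Exists x A; deduction ar D2; concl D2 = C;
      a \<notin> params C; a \<notin> params (Exists x A);
      \<forall>(v, B) \<in> opens D2 - {(u, subst x (Par a) A), (u, Ext (Tm (Par a)))}. a \<notin> params B\<rbrakk>
     \<Longrightarrow> deduction ar (Infer (ExE u a) [D1, D2] C)"
| eqI:
    "\<lbrakk>deduction ar D; concl D = Ext (Tm t)\<rbrakk>
     \<Longrightarrow> deduction ar (Infer EqI [D] (Eq (Tm t) (Tm t)))"
| eqE:
    "\<lbrakk>deduction ar D1; concl D1 = Eq (Tm t1) (Tm t2); t1 \<noteq> t2;
      deduction ar D2; concl D2 = subst x t1 A; prime (subst x t2 A)\<rbrakk>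
     \<Longrightarrow> deduction ar (Infer EqE [D1, D2] (subst x t2 A))"
| ad_rel:
    "\<lbrakk>deduction ar D; concl D = Rel P ss; s \<in> set ss\<rbrakk>
     \<Longrightarrow> deduction ar (Infer AD [D] (Ext s))"
| ad_eq:
    "\<lbrakk>deduction ar D; concl D = Eq s1 s2; s \<in> {s1, s2}\<rbrakk>
     \<Longrightarrow> deduction ar (Infer AD [D] (Ext s))"

definition deduction_from ::
  "('p \<Rightarrow> nat) \<Rightarrow> ('c, 'p) fm set \<Rightarrow> ('c, 'p) fm \<Rightarrow> ('c, 'p) ded \<Rightarrow> bool"
where
  "deduction_from ar \<Gamma> A D \<longleftrightarrow> deduction ar D \<and> concl D = A \<and> snd ` opens D \<subseteq> \<Gamma>"

lemma vars_subst_arg [simp]: "vars_arg (subst_arg x t s) = vars_arg s - {x}"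
  by (cases s) auto

lemma free_vars_subst [simp]: "free_vars (subst x t A) = free_vars A - {x}"
  by (induction A) auto

lemma arity_ok_subst [simp]: "arity_ok ar (subst x t A) = arity_ok ar A"
  by (induction A) auto

lemma deduction_formula: "deduction ar D \<Longrightarrow> formula ar (concl D)"
  by (induction rule: deduction.induct) (auto simp: formula_def)

text \<open>A formula occurrence in a deduction is a node of the tree, given by the path to it from the
  root: \<open>p @ [i]\<close> is the \<open>i\<close>-th premise (counted from 0, left to right) of the inference with
  conclusion \<open>p\<close>. So \<open>butlast p\<close> is the conclusion of the inference of which \<open>p\<close> is a premise.\<close>

type_synonym occ = "nat list"

primrec prems :: "('c, 'p) ded \<Rightarrow> ('c, 'p) ded list" where
  "prems (Assume u A) = []"
| "prems (Infer r Ds A) = Ds"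

primrec sub_ded :: "('c, 'p) ded \<Rightarrow> occ \<Rightarrow> ('c, 'p) ded option" where
  "sub_ded D [] = Some D"
| "sub_ded D (i # p) = (if i < length (prems D) then sub_ded (prems D ! i) p else None)"

definition occs :: "('c, 'p) ded \<Rightarrow> occ set" where
  "occs D = {p. sub_ded D p \<noteq> None}"

definition fm_at :: "('c, 'p) ded \<Rightarrow> occ \<Rightarrow> ('c, 'p) fm" where
  "fm_at D p = concl (the (sub_ded D p))"

definition concluded_by :: "('c, 'p) ded \<Rightarrow> rule set \<Rightarrow> occ \<Rightarrow> bool" where
  "concluded_by D R p \<longleftrightarrow> (\<exists>r \<in> R. \<exists>Ds A. sub_ded D p = Some (Infer r Ds A))"

definition premise_of :: "('c, 'p) ded \<Rightarrow> rule set \<Rightarrow> occ \<Rightarrow> bool" where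
  "premise_of D R p \<longleftrightarrow> p \<in> occs D \<and> p \<noteq> [] \<and> concluded_by D R (butlast p)"

text \<open>Meaningful for elimination rules only, whose leftmost premise is the major one.\<close>

definition major_premise_of :: "('c, 'p) ded \<Rightarrow> rule set \<Rightarrow> occ \<Rightarrow> bool" where
  "major_premise_of D R p \<longleftrightarrow> premise_of D R p \<and> last p = 0"

definition minor_premise_of :: "('c, 'p) ded \<Rightarrow> rule set \<Rightarrow> occ \<Rightarrow> bool" where
  "minor_premise_of D R p \<longleftrightarrow> premise_of D R p \<and> last p \<noteq> 0"

definition intro_rules :: "rule set" where
  "intro_rules = {AndI, OrI, ExI, EqI} \<union> range ImpI \<union> {AllI u a | u a. True}"

definition or_ex_elims :: "rule set" where
  "or_ex_elims = range OrE \<union> {ExE u a | u a. True}"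

definition elim_rules :: "rule set" where
  "elim_rules = {AndE, ImpE, BotE, AllE, EqE} \<union> or_ex_elims"

definition segment :: "('c, 'p) ded \<Rightarrow> occ list \<Rightarrow> bool" where
  "segment D \<sigma> \<longleftrightarrow> \<sigma> \<noteq> [] \<and> set \<sigma> \<subseteq> occs D \<and>
     \<not> concluded_by D or_ex_elims (hd \<sigma>) \<and>
     \<not> minor_premise_of D or_ex_elims (last \<sigma>) \<and>
     (\<forall>i. Suc i < length \<sigma> \<longrightarrow>
        minor_premise_of D or_ex_elims (\<sigma> ! i) \<and> \<sigma> ! Suc i = butlast (\<sigma> ! i))"

definition maximal_elim_segment :: "('c, 'p) ded \<Rightarrow> occ list \<Rightarrow> bool" where
  "maximal_elim_segment D \<sigma> \<longleftrightarrow> segment D \<sigma> \<and>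
     major_premise_of D elim_rules (last \<sigma>) \<and>
     (length \<sigma> = 1 \<longrightarrow> concluded_by D intro_rules (hd \<sigma>))"

definition maximal_eq_segment :: "('c, 'p) ded \<Rightarrow> occ list \<Rightarrow> bool" where
  "maximal_eq_segment D \<sigma> \<longleftrightarrow> segment D \<sigma> \<and>
     (\<exists>t. \<forall>p \<in> set \<sigma>. fm_at D p = Eq (Tm t) (Tm t)) \<and>
     concluded_by D {EqI} (hd \<sigma>) \<and> premise_of D {AD} (last \<sigma>)"

definition maximal_ext_segment :: "('c, 'p) ded \<Rightarrow> occ list \<Rightarrow> bool" where
  "maximal_ext_segment D \<sigma> \<longleftrightarrow> segment D \<sigma> \<and>
     (\<exists>t. (\<forall>p \<in> set \<sigma>. fm_at D p = Ext (Tm t)) \<and>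
          concluded_by D {AD} (hd \<sigma>) \<and> fm_at D (hd \<sigma> @ [0]) = Eq (Tm t) (Tm t)) \<and>
     premise_of D {EqI} (last \<sigma>)"

text \<open>A segment is a premise of a rule if its last formula is, and a conclusion if its
  first formula is.\<close>

definition eqE_segment :: "('c, 'p) ded \<Rightarrow> occ list list \<Rightarrow> bool" where
  "eqE_segment D \<sigma>s \<longleftrightarrow> \<sigma>s \<noteq> [] \<and> (\<forall>\<sigma> \<in> set \<sigma>s. segment D \<sigma>) \<and>
     minor_premise_of D {EqE} (last (hd \<sigma>s)) \<and> \<not> concluded_by D {EqE} (hd (hd \<sigma>s)) \<and>
     concluded_by D {EqE} (hd (last \<sigma>s)) \<and> \<not> minor_premise_of D {EqE} (last (last \<sigma>s)) \<and>
     (\<forall>i. 0 < i \<and> Suc i < length \<sigma>s \<longrightarrow>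
        concluded_by D {EqE} (hd (\<sigma>s ! i)) \<and> minor_premise_of D {EqE} (last (\<sigma>s ! i))) \<and>
     (\<forall>i. Suc i < length \<sigma>s \<longrightarrow> hd (\<sigma>s ! Suc i) = butlast (last (\<sigma>s ! i)))"

definition maximal_eqE_segment :: "('c, 'p) ded \<Rightarrow> occ list list \<Rightarrow> bool" where
  "maximal_eqE_segment D \<sigma>s \<longleftrightarrow> eqE_segment D \<sigma>s \<and>
     (premise_of D {AD} (last (last \<sigma>s)) \<or>
      (\<forall>\<sigma> \<in> set \<sigma>s. \<forall>p \<in> set \<sigma>. \<exists>t. fm_at D p = Ext (Tm t)))"

definition normal :: "('c, 'p) ded \<Rightarrow> bool" where
  "normal D \<longleftrightarrow>
     (\<nexists>\<sigma>. maximal_elim_segment D \<sigma>) \<and> (\<nexists>\<sigma>. maximal_eq_segment D \<sigma>) \<and>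
     (\<nexists>\<sigma>. maximal_ext_segment D \<sigma>) \<and> (\<nexists>\<sigma>s. maximal_eqE_segment D \<sigma>s)"

end

theory Submission
  imports Defs
begin

text \<open>Normalization by evaluation. Finite sets of formulas are the worlds of a Beth-style model:
  a prime formula is forced if, after finitely many case distinctions on neutral disjunctions and
  existential formulas, it has a normal deduction not ending in \<open>\<or>E\<close> or \<open>\<exists>E\<close>. The model is sound
  for \<open>INF\<close>; the rules for \<open>=\<close> and \<open>\<exists>!\<close> hold because their maximal segments can be removed from such
  deductions. Every formula with a neutral deduction is forced, and every forced formula
  has a normal deduction.\<close>

text \<open>Reducing maximal segments one by one would need a termination measure, since a reduction
  may create new ones. Here the given deduction is only evaluated, and the normal one is read back
  from the result. A Kripke model would not do: a neutral deduction of a disjunction does not tell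
  which disjunct holds, so forcing must be allowed to wait for a case distinction. Keeping
  \<open>OrE\<close> and \<open>ExE\<close> out of the deductions at the leaves has a second effect:
  every case distinction is pushed below the applications of \<open>EqI\<close>, \<open>EqE\<close>
  and \<open>AD\<close>, so that no segment of length greater than 1 ends in a premise of one of
  these rules. Normality, which speaks of paths through the tree, thereby follows from a condition
  on single inferences. Worlds are finite so that a fresh eigenparameter is available whenever a
  forced formula is turned back into a deduction.\<close>

section \<open>Local conditions on inferences that imply normality\<close>

definition ends :: "rule set \<Rightarrow> ('c, 'p) ded \<Rightarrow> bool" where
  "ends R D \<longleftrightarrow> (\<exists>r \<in> R. \<exists>Ds A. D = Infer r Ds A)"

lemma ends_simps [simp]:
  "\<not> ends R (Assume u A)"
  "ends R (Infer r Ds A) \<longleftrightarrow> r \<in> R"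
  "\<not> ends {} D"
  by (auto simp: ends_def)

lemma ends_mono: "ends R D \<Longrightarrow> R \<subseteq> R' \<Longrightarrow> ends R' D"
  by (auto simp: ends_def)

lemma rule_class_simps [simp]:
  "AndI \<in> intro_rules" "ImpI u \<in> intro_rules" "OrI \<in> intro_rules" "AllI u a \<in> intro_rules"
  "ExI \<in> intro_rules" "EqI \<in> intro_rules"
  "AndE \<notin> intro_rules" "ImpE \<notin> intro_rules" "OrE u \<notin> intro_rules" "BotE \<notin> intro_rules"
  "AllE \<notin> intro_rules" "ExE u a \<notin> intro_rules" "EqE \<notin> intro_rules" "AD \<notin> intro_rules"
  "OrE u \<in> or_ex_elims" "ExE u a \<in> or_ex_elims"
  "AndI \<notin> or_ex_elims" "ImpI u \<notin> or_ex_elims" "OrI \<notin> or_ex_elims" "AllI u a \<notin> or_ex_elims"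
  "ExI \<notin> or_ex_elims" "EqI \<notin> or_ex_elims" "AndE \<notin> or_ex_elims" "ImpE \<notin> or_ex_elims"
  "BotE \<notin> or_ex_elims" "AllE \<notin> or_ex_elims" "EqE \<notin> or_ex_elims" "AD \<notin> or_ex_elims"
  "AndE \<in> elim_rules" "ImpE \<in> elim_rules" "BotE \<in> elim_rules" "AllE \<in> elim_rules"
  "EqE \<in> elim_rules" "OrE u \<in> elim_rules" "ExE u a \<in> elim_rules"
  "AndI \<notin> elim_rules" "ImpI u \<notin> elim_rules" "OrI \<notin> elim_rules" "AllI u a \<notin> elim_rules"
  "ExI \<notin> elim_rules" "EqI \<notin> elim_rules" "AD \<notin> elim_rules"
  by (auto simp: intro_rules_def or_ex_elims_def elim_rules_def)

text \<open>Stronger than normality requires: barring \<open>\<or>E\<close> and \<open>\<exists>E\<close> above both premises of \<open>EqE\<close> lets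
  \<open>AD\<close> be moved up through a chain of \<open>EqE\<close> (lemma \<open>deduction_deriv_Ext\<close>).\<close>

definition inference_ok :: "rule \<Rightarrow> ('c, 'p) ded list \<Rightarrow> ('c, 'p) fm \<Rightarrow> bool" where
  "inference_ok r Ds A \<longleftrightarrow>
     (r \<in> elim_rules \<longrightarrow> \<not> ends (intro_rules \<union> or_ex_elims) (hd Ds)) \<and>
     (r = AD \<longrightarrow> Ds \<noteq> [] \<and> (\<forall>D \<in> set Ds. \<not> ends ({EqI, EqE} \<union> or_ex_elims) D)) \<and>
     (r = EqI \<longrightarrow> (\<forall>D \<in> set Ds. \<not> ends or_ex_elims D \<and>
        \<not> (ends {AD} D \<and> (\<exists>t. concl (hd (prems D)) = Eq (Tm t) (Tm t))))) \<and>
     (r = EqE \<longrightarrow> (\<nexists>t. A = Ext (Tm t)) \<and> (\<forall>D \<in> set Ds. \<not> ends or_ex_elims D))"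

primrec inferences_ok :: "('c, 'p) ded \<Rightarrow> bool" where
  "inferences_ok (Assume u A) = True"
| "inferences_ok (Infer r Ds A) = (list_all id (map inferences_ok Ds) \<and> inference_ok r Ds A)"

lemma inferences_ok_sub_ded:
  "inferences_ok D \<Longrightarrow> sub_ded D p = Some D' \<Longrightarrow> inferences_ok D'"
proof (induction p arbitrary: D)
  case (Cons i p)
  then show ?case
    by (cases D) (auto simp: list_all_length split: if_splits)
qed simp

lemma sub_ded_snoc:
  "sub_ded D (p @ [i]) =
     (case sub_ded D p of None \<Rightarrow> None
      | Some D' \<Rightarrow> if i < length (prems D') then Some (prems D' ! i) else None)"
  by (induction p arbitrary: D) auto

lemma premise_ofE:
  assumes "premise_of D R p"
  obtains q i r Ds A where "p = q @ [i]" "r \<in> R" "sub_ded D q = Some (Infer r Ds A)"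
    "i < length Ds" "sub_ded D p = Some (Ds ! i)"
proof -
  obtain q i where p: "p = q @ [i]"
    using assms by (cases p rule: rev_cases) (auto simp: premise_of_def)
  then obtain r Ds A where *: "r \<in> R" "sub_ded D q = Some (Infer r Ds A)"
    using assms by (auto simp: premise_of_def concluded_by_def)
  with p assms have "i < length Ds" "sub_ded D p = Some (Ds ! i)"
    by (auto simp: premise_of_def occs_def sub_ded_snoc split: if_splits)
  with p * that show ?thesis by blast
qed

lemma concluded_by_iff_ends: "sub_ded D p = Some D' \<Longrightarrow> concluded_by D R p \<longleftrightarrow> ends R D'"
  by (auto simp: concluded_by_def ends_def)

text \<open>In a segment of length at least 2 the last formula is the conclusion of the inference
  that has the penultimate one as a minor premise, and that inference is \<open>OrE\<close> or
  \<open>ExE\<close>. A rule whose premise must not end in these two can therefore only meet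
  segments of length 1.\<close>

lemma segment_cases:
  assumes "segment D \<sigma>"
  obtains p where "\<sigma> = [p]" | "length \<sigma> \<noteq> 1" "concluded_by D or_ex_elims (last \<sigma>)"
proof (cases "length \<sigma> = 1")
  case True
  then show ?thesis using that(1) by (auto simp: length_Suc_conv)
next
  case False
  with assms have l: "length \<sigma> \<ge> 2"
    unfolding segment_def by (cases \<sigma>) (auto simp: neq_Nil_conv)
  let ?i = "length \<sigma> - 2"
  have "Suc ?i < length \<sigma>" "Suc ?i = length \<sigma> - 1" using l by auto
  with assms have "minor_premise_of D or_ex_elims (\<sigma> ! ?i)" "last \<sigma> = butlast (\<sigma> ! ?i)"
    unfolding segment_def by (metis, metis last_conv_nth)
  then have "concluded_by D or_ex_elims (last \<sigma>)"
    by (simp add: minor_premise_of_def premise_of_def)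
  with False that(2) show ?thesis by blast
qed

text \<open>The rule below a maximal segment bars \<open>OrE\<close> and \<open>ExE\<close> above
  the premise in question, so by \<open>segment_cases\<close> the segment is a single occurrence,
  and \<open>inference_ok\<close> forbids the two inferences around it. For
  \<open>EqE\<close>-segments it suffices to look at the last segment: either it is a premise of
  \<open>AD\<close> concluded by \<open>EqE\<close>, or \<open>EqE\<close> has concluded an
  existence formula.\<close>

lemma normal_if_inferences_ok:
  assumes ok: "inferences_ok D"
  shows "normal D"
proof -
  have premise: "\<exists>r Ds A i D'. r \<in> R \<and> inference_ok r Ds A \<and> i < length Ds \<and> i = last p \<and>
      D' = Ds ! i \<and> sub_ded D p = Some D' \<and> (\<forall>R. concluded_by D R p \<longleftrightarrow> ends R D')"
    if "premise_of D R p" for R p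
    using that
  proof (rule premise_ofE)
    fix q i r Ds A
    assume *: "p = q @ [i]" "r \<in> R" "sub_ded D q = Some (Infer r Ds A)"
      "i < length Ds" "sub_ded D p = Some (Ds ! i)"
    then show ?thesis
      using inferences_ok_sub_ded[OF ok *(3)] concluded_by_iff_ends[OF *(5)] by auto
  qed
  have AD: "\<not> concluded_by D ({EqI, EqE} \<union> or_ex_elims) p" if "premise_of D {AD} p" for p
    using premise[OF that] by (auto simp: inference_ok_def)
  have "\<not> maximal_elim_segment D \<sigma>" for \<sigma>
  proof
    assume m: "maximal_elim_segment D \<sigma>"
    then have "premise_of D elim_rules (last \<sigma>)" "last (last \<sigma>) = 0"
      by (auto simp: maximal_elim_segment_def major_premise_of_def)
    with premise[OF this(1)]
    have "\<not> concluded_by D (intro_rules \<union> or_ex_elims) (last \<sigma>)"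
      by (auto simp: inference_ok_def hd_conv_nth)
    then have "\<not> concluded_by D intro_rules (last \<sigma>)" "\<not> concluded_by D or_ex_elims (last \<sigma>)"
      by (auto simp: concluded_by_def)
    moreover have "segment D \<sigma>" using m by (simp add: maximal_elim_segment_def)
    ultimately show False
      using m by (auto elim!: segment_cases simp: maximal_elim_segment_def)
  qed
  moreover have "\<not> maximal_eq_segment D \<sigma>" for \<sigma>
  proof
    assume m: "maximal_eq_segment D \<sigma>"
    then have "segment D \<sigma>" and "\<not> concluded_by D ({EqI, EqE} \<union> or_ex_elims) (last \<sigma>)"
      using AD by (auto simp: maximal_eq_segment_def)
    with m show False
      by (auto elim!: segment_cases simp: maximal_eq_segment_def concluded_by_def)
  qed
  moreover have "\<not> maximal_ext_segment D \<sigma>" for \<sigma>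
  proof
    assume m: "maximal_ext_segment D \<sigma>"
    then have seg: "segment D \<sigma>" and p: "premise_of D {EqI} (last \<sigma>)"
      by (auto simp: maximal_ext_segment_def)
    obtain D' where D': "sub_ded D (last \<sigma>) = Some D'" "\<not> ends or_ex_elims D'"
        "\<not> (ends {AD} D' \<and> (\<exists>t. concl (hd (prems D')) = Eq (Tm t) (Tm t)))"
      using premise[OF p] by (auto simp: inference_ok_def)
    from seg show False
    proof (cases rule: segment_cases)
      case (1 q)
      with m D'(1) obtain t Ds A where *: "D' = Infer AD Ds A" "fm_at D (q @ [0]) = Eq (Tm t) (Tm t)"
        by (auto simp: maximal_ext_segment_def concluded_by_def)
      show False
      proof (cases Ds)
        \<comment> \<open>\<open>D\<close> is an arbitrary tree here, so an \<open>AD\<close>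
          without premises is conceivable, and \<open>hd\<close> would be unspecified on it. The
          clause \<open>Ds \<noteq> []\<close> of \<open>inference_ok\<close> excludes this.\<close>
        case Nil
        with * inferences_ok_sub_ded[OF ok D'(1)] show False by (simp add: inference_ok_def)
      next
        case (Cons E Es)
        then have "fm_at D (q @ [0]) = concl E"
          using * D'(1) 1 by (simp add: fm_at_def sub_ded_snoc)
        then show False using D'(3) * Cons by (metis ends_simps(2) insertI1 list.sel(1) prems.simps(2))
      qed
    next
      case 2
      then show False using D' by (simp add: concluded_by_iff_ends)
    qed
  qed
  moreover have "\<not> maximal_eqE_segment D \<sigma>s" for \<sigma>s
  proof
    assume m: "maximal_eqE_segment D \<sigma>s"
    then have ne: "\<sigma>s \<noteq> []" and seg: "segment D (last \<sigma>s)"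
        and c: "concluded_by D {EqE} (hd (last \<sigma>s))"
      by (auto simp: maximal_eqE_segment_def eqE_segment_def)
    from m consider "premise_of D {AD} (last (last \<sigma>s))"
      | "\<forall>\<sigma> \<in> set \<sigma>s. \<forall>p \<in> set \<sigma>. \<exists>t. fm_at D p = Ext (Tm t)"
      by (auto simp: maximal_eqE_segment_def)
    then show False
    proof cases
      case 1
      from seg AD[OF 1] c show False
        by (auto elim!: segment_cases simp: concluded_by_def)
    next
      case 2
      from c obtain Ds A where *: "sub_ded D (hd (last \<sigma>s)) = Some (Infer EqE Ds A)"
        by (auto simp: concluded_by_def)
      then have "inference_ok EqE Ds A" using inferences_ok_sub_ded[OF ok] by fastforce
      moreover have "\<exists>t. A = Ext (Tm t)"
      proof -
        have "last \<sigma>s \<in> set \<sigma>s" "hd (last \<sigma>s) \<in> set (last \<sigma>s)"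
          using ne seg by (auto simp: segment_def)
        with 2 have "\<exists>t. fm_at D (hd (last \<sigma>s)) = Ext (Tm t)" by blast
        with * show ?thesis by (simp add: fm_at_def)
      qed
      ultimately show False by (simp add: inference_ok_def)
    qed
  qed
  ultimately show ?thesis by (simp add: normal_def)
qed

section \<open>Open assumptions and parameters of deductions\<close>

lemma opens_simps [simp]:
  "opens (Infer AndI [D1, D2] C) = opens D1 \<union> opens D2"
  "opens (Infer AndE [D] C) = opens D"
  "opens (Infer (ImpI u) [D] (Impl A B)) = opens D - {(u, A)}"
  "opens (Infer ImpE [D1, D2] C) = opens D1 \<union> opens D2"
  "opens (Infer OrI [D] C) = opens D"
  "opens (Infer BotE [D] C) = opens D"
  "opens (Infer (AllI u a) [D] C) = opens D - {(u, Ext (Tm (Par a)))}"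
  "opens (Infer AllE [D1, D2] C) = opens D1 \<union> opens D2"
  "opens (Infer ExI [D1, D2] C) = opens D1 \<union> opens D2"
  "opens (Infer EqI [D] C) = opens D"
  "opens (Infer EqE [D1, D2] C) = opens D1 \<union> opens D2"
  "opens (Infer AD [D] C) = opens D"
  by (auto simp: discharged_def lessThan_Suc)

lemma opens_OrE:
  "concl D = Disj A B \<Longrightarrow>
   opens (Infer (OrE u) [D, D1, D2] C) = opens D \<union> (opens D1 - {(u, A)}) \<union> (opens D2 - {(u, B)})"
  by (auto simp: discharged_def lessThan_Suc)

lemma opens_ExE:
  "concl D1 = Exists x A \<Longrightarrow>
   opens (Infer (ExE u a) [D1, D2] C) =
     opens D1 \<union> (opens D2 - {(u, subst x (Par a) A), (u, Ext (Tm (Par a)))})"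
  by (auto simp: discharged_def lessThan_Suc)

declare opens.simps(2) [simp del]

lemma opens_formula: "deduction ar D \<Longrightarrow> (u, A) \<in> opens D \<Longrightarrow> formula ar A"
  by (induction arbitrary: u A rule: deduction.induct) (auto simp: opens_OrE opens_ExE)

lemma finite_opens: "finite (opens D)"
  by (induction D) (auto simp: opens.simps(2))

lemma finite_params_arg: "finite (params_arg s)"
  by (cases s) (auto split: trm.split)

lemma finite_params: "finite (params A)"
  by (induction A) (auto simp: finite_params_arg)

section \<open>Normal derivability\<close>

text \<open>All assumptions carry the label 0, so that every inference discharges as much as possible.\<close>

definition deriv ::
  "('p \<Rightarrow> nat) \<Rightarrow> rule set \<Rightarrow> ('c, 'p) fm set \<Rightarrow> ('c, 'p) fm \<Rightarrow> bool"
where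
  "deriv ar R \<Gamma> A \<longleftrightarrow>
     (\<exists>D. deduction ar D \<and> concl D = A \<and> opens D \<subseteq> {0} \<times> \<Gamma> \<and> inferences_ok D \<and> \<not> ends R D)"

abbreviation "normal_deriv ar \<equiv> deriv ar {}"
text \<open>Neutral deductions are those that may stand above the major premise of an elimination
  without completing a maximal segment.\<close>

abbreviation "neutral ar \<equiv> deriv ar (intro_rules \<union> or_ex_elims)"

lemma derivE:
  assumes "deriv ar R \<Gamma> A"
  obtains D where "deduction ar D" "concl D = A" "opens D \<subseteq> {0} \<times> \<Gamma>" "inferences_ok D"
    "\<not> ends R D"
  using assms by (auto simp: deriv_def)

lemma derivI:
  "deduction ar D \<Longrightarrow> concl D = A \<Longrightarrow> opens D \<subseteq> {0} \<times> \<Gamma> \<Longrightarrow> inferences_ok D \<Longrightarrow> \<not> ends R D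
   \<Longrightarrow> deriv ar R \<Gamma> A"
  by (auto simp: deriv_def)

lemma deriv_mono: "deriv ar R \<Gamma> A \<Longrightarrow> \<Gamma> \<subseteq> \<Delta> \<Longrightarrow> R' \<subseteq> R \<Longrightarrow> deriv ar R' \<Delta> A"
  unfolding deriv_def using ends_mono by blast

lemma neutral_Assume: "formula ar A \<Longrightarrow> A \<in> \<Gamma> \<Longrightarrow> neutral ar \<Gamma> A"
  by (rule derivI[of _ "Assume 0 A"]) (auto intro: deduction.intros)

lemma deriv_Infer1:
  assumes "deriv ar R \<Gamma> A" "r \<notin> R'"
    and "\<And>D. deduction ar D \<Longrightarrow> concl D = A \<Longrightarrow> opens D \<subseteq> {0} \<times> \<Gamma> \<Longrightarrow> \<not> ends R D \<Longrightarrow>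
      deduction ar (Infer r [D] C) \<and> inference_ok r [D] C \<and> opens (Infer r [D] C) \<subseteq> {0} \<times> \<Delta>"
  shows "deriv ar R' \<Delta> C"
proof -
  obtain D where "deduction ar D" "concl D = A" "opens D \<subseteq> {0} \<times> \<Gamma>" "inferences_ok D" "\<not> ends R D"
    using assms(1) by (rule derivE)
  with assms(2,3) show ?thesis by (intro derivI[of _ "Infer r [D] C"]) auto
qed

lemma deriv_Infer2:
  assumes "deriv ar R1 \<Gamma>1 A1" "deriv ar R2 \<Gamma>2 A2" "r \<notin> R'"
    and "\<And>D1 D2. deduction ar D1 \<Longrightarrow> concl D1 = A1 \<Longrightarrow> opens D1 \<subseteq> {0} \<times> \<Gamma>1 \<Longrightarrow> \<not> ends R1 D1 \<Longrightarrow>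
      deduction ar D2 \<Longrightarrow> concl D2 = A2 \<Longrightarrow> opens D2 \<subseteq> {0} \<times> \<Gamma>2 \<Longrightarrow> \<not> ends R2 D2 \<Longrightarrow>
      deduction ar (Infer r [D1, D2] C) \<and> inference_ok r [D1, D2] C \<and>
      opens (Infer r [D1, D2] C) \<subseteq> {0} \<times> \<Delta>"
  shows "deriv ar R' \<Delta> C"
proof -
  obtain D1 where "deduction ar D1" "concl D1 = A1" "opens D1 \<subseteq> {0} \<times> \<Gamma>1" "inferences_ok D1"
    "\<not> ends R1 D1"
    using assms(1) by (rule derivE)
  moreover obtain D2 where "deduction ar D2" "concl D2 = A2" "opens D2 \<subseteq> {0} \<times> \<Gamma>2"
    "inferences_ok D2" "\<not> ends R2 D2"
    using assms(2) by (rule derivE)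
  ultimately show ?thesis
    using assms(3,4) by (intro derivI[of _ "Infer r [D1, D2] C"]) auto
qed

lemma neutral_Conj:
  assumes "neutral ar \<Gamma> (Conj A B)"
  shows "neutral ar \<Gamma> A" "neutral ar \<Gamma> B"
  by (rule deriv_Infer1[OF assms, where r = AndE];
      auto simp: inference_ok_def intro: deduction.intros)+

lemma neutral_Impl:
  assumes "neutral ar \<Gamma> (Impl A B)" "normal_deriv ar \<Gamma> A"
  shows "neutral ar \<Gamma> B"
  by (rule deriv_Infer2[OF assms, where r = ImpE])
    (auto simp: inference_ok_def intro: deduction.intros)

lemma neutral_Forall:
  assumes "neutral ar \<Gamma> (Forall x A)" "normal_deriv ar \<Gamma> (Ext (Tm t))"
  shows "neutral ar \<Gamma> (subst x t A)"
  by (rule deriv_Infer2[OF assms, where r = AllE])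
    (auto simp: inference_ok_def intro: deduction.intros)

lemma normal_deriv_Conj:
  assumes "normal_deriv ar \<Gamma> A" "normal_deriv ar \<Gamma> B"
  shows "normal_deriv ar \<Gamma> (Conj A B)"
  by (rule deriv_Infer2[OF assms, where r = AndI])
    (auto simp: inference_ok_def intro: deduction.intros)

lemma normal_deriv_Impl:
  assumes "normal_deriv ar (insert A \<Gamma>) B" "formula ar A"
  shows "normal_deriv ar \<Gamma> (Impl A B)"
  by (rule deriv_Infer1[OF assms(1), where r = "ImpI 0"])
    (use assms(2) in \<open>auto simp: inference_ok_def intro: deduction.intros\<close>)

lemma normal_deriv_Disj1:
  assumes "normal_deriv ar \<Gamma> A" "formula ar B"
  shows "normal_deriv ar \<Gamma> (Disj A B)"
  by (rule deriv_Infer1[OF assms(1), where r = OrI])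
    (use assms(2) in \<open>auto simp: inference_ok_def intro: deduction.intros\<close>)

lemma normal_deriv_Disj2:
  assumes "normal_deriv ar \<Gamma> B" "formula ar A"
  shows "normal_deriv ar \<Gamma> (Disj A B)"
  by (rule deriv_Infer1[OF assms(1), where r = OrI])
    (use assms(2) in \<open>auto simp: inference_ok_def intro: deduction.intros\<close>)

lemma normal_deriv_Exists:
  assumes "normal_deriv ar \<Gamma> (subst x t A)" "normal_deriv ar \<Gamma> (Ext (Tm t))"
  shows "normal_deriv ar \<Gamma> (Exists x A)"
  by (rule deriv_Infer2[OF assms, where r = ExI])
    (auto simp: inference_ok_def intro: deduction.intros)

lemma fresh_param:
  assumes "finite \<Gamma>"
  obtains a where "\<And>A. A \<in> \<Gamma> \<Longrightarrow> a \<notin> params A"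
proof -
  have "finite (\<Union>A \<in> \<Gamma>. params A)" using assms by (simp add: finite_params)
  then obtain a where "a \<notin> (\<Union>A \<in> \<Gamma>. params A)"
    using ex_new_if_finite infinite_UNIV_nat by blast
  then show thesis using that by blast
qed

lemma normal_deriv_Forall:
  assumes "normal_deriv ar (insert (Ext (Tm (Par a))) \<Gamma>) (subst x (Par a) A)"
    and "a \<notin> params (Forall x A)" "\<And>B. B \<in> \<Gamma> \<Longrightarrow> a \<notin> params B"
  shows "normal_deriv ar \<Gamma> (Forall x A)"
proof (rule deriv_Infer1[OF assms(1), where r = "AllI 0 a"])
  fix D
  assume "deduction ar D" "concl D = subst x (Par a) A"
    "opens D \<subseteq> {0} \<times> insert (Ext (Tm (Par a))) \<Gamma>"
  moreover from this have "deduction ar (Infer (AllI 0 a) [D] (Forall x A))"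
    using assms(2,3) by (intro deduction.allI) auto
  ultimately show "deduction ar (Infer (AllI 0 a) [D] (Forall x A)) \<and>
      inference_ok (AllI 0 a) [D] (Forall x A) \<and>
      opens (Infer (AllI 0 a) [D] (Forall x A)) \<subseteq> {0} \<times> \<Gamma>"
    by (auto simp: inference_ok_def)
qed simp

lemma normal_deriv_OrE:
  assumes "neutral ar \<Gamma> (Disj A B)" "normal_deriv ar (insert A \<Gamma>) C" "normal_deriv ar (insert B \<Gamma>) C"
  shows "normal_deriv ar \<Gamma> C"
proof -
  obtain D where D: "deduction ar D" "concl D = Disj A B" "opens D \<subseteq> {0} \<times> \<Gamma>" "inferences_ok D"
    "\<not> ends (intro_rules \<union> or_ex_elims) D"
    using assms(1) by (rule derivE)
  obtain D1 where D1: "deduction ar D1" "concl D1 = C" "opens D1 \<subseteq> {0} \<times> insert A \<Gamma>"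
    "inferences_ok D1"
    using assms(2) by (rule derivE)
  obtain D2 where D2: "deduction ar D2" "concl D2 = C" "opens D2 \<subseteq> {0} \<times> insert B \<Gamma>"
    "inferences_ok D2"
    using assms(3) by (rule derivE)
  show ?thesis
    using D D1 D2
    by (intro derivI[of _ "Infer (OrE 0) [D, D1, D2] C"])
      (auto simp: inference_ok_def opens_OrE intro!: deduction.orE)
qed

lemma normal_deriv_ExE:
  assumes "neutral ar \<Gamma> (Exists x A)"
    and "normal_deriv ar (insert (Ext (Tm (Par a))) (insert (subst x (Par a) A) \<Gamma>)) C"
    and "a \<notin> params C" "a \<notin> params (Exists x A)" "\<And>B. B \<in> \<Gamma> \<Longrightarrow> a \<notin> params B"
  shows "normal_deriv ar \<Gamma> C"
proof (rule deriv_Infer2[OF assms(1,2), where r = "ExE 0 a"])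
  fix D1 D2
  assume "deduction ar D1" "concl D1 = Exists x A" "opens D1 \<subseteq> {0} \<times> \<Gamma>"
    "\<not> ends (intro_rules \<union> or_ex_elims) D1" "deduction ar D2" "concl D2 = C"
    "opens D2 \<subseteq> {0} \<times> insert (Ext (Tm (Par a))) (insert (subst x (Par a) A) \<Gamma>)"
  moreover from this have "deduction ar (Infer (ExE 0 a) [D1, D2] C)"
    using assms(3-5) by (intro deduction.exE[where x = x and A = A]) auto
  ultimately show "deduction ar (Infer (ExE 0 a) [D1, D2] C) \<and>
      inference_ok (ExE 0 a) [D1, D2] C \<and> opens (Infer (ExE 0 a) [D1, D2] C) \<subseteq> {0} \<times> \<Gamma>"
    by (auto simp: inference_ok_def opens_ExE)
qed simp

section \<open>Prime formulas\<close>

text \<open>Unlike \<open>neutral\<close>, this admits \<open>EqI\<close> as last rule, which for a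
  prime formula is the only possible introduction.\<close>

abbreviation "deriv_prime ar \<equiv> deriv ar or_ex_elims"

text \<open>These are the arguments about which \<open>AD\<close> can conclude existence; hence the
  empty set for \<open>Ext\<close> and for every formula that is not prime.\<close>

primrec args :: "('c, 'p) fm \<Rightarrow> 'c arg set" where
  "args (Rel P ss) = set ss"
| "args (Ext s) = {}"
| "args (Eq s s') = {s, s'}"
| "args Falsum = {}"
| "args (Conj A B) = {}"
| "args (Disj A B) = {}"
| "args (Impl A B) = {}"
| "args (Exists x A) = {}"
| "args (Forall x A) = {}"

lemma args_subst: "args (subst x t A) = subst_arg x t ` args A"
  by (cases A) auto

text \<open>An argument place either held the variable \<open>x\<close>, and then shows
  \<open>t2\<close>, or is unaffected by the choice of the substituted term. This decides to which
  premise of \<open>EqE\<close> an \<open>AD\<close> below it is moved.\<close>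

lemma args_subst_cases:
  assumes "s \<in> args (subst x t2 A)"
  obtains "s = Tm t2" | "s \<in> args (subst x t1 A)"
proof -
  from assms obtain s' where "s' \<in> args A" "s = subst_arg x t2 s'" by (auto simp: args_subst)
  then show thesis
    using that by (cases s') (force simp: args_subst split: if_splits)+
qed

lemma deriv_Ext_direct:
  assumes "deduction ar D" "inferences_ok D" "\<not> ends ({EqI, EqE} \<union> or_ex_elims) D"
    "s \<in> args (concl D)" "opens D \<subseteq> {0} \<times> \<Gamma>"
  shows "deriv_prime ar \<Gamma> (Ext s)"
proof -
  have "deduction ar (Infer AD [D] (Ext s))"
    using assms(1,4) by (cases "concl D") (auto intro: deduction.intros)
  then show ?thesis
    using assms by (intro derivI[of _ "Infer AD [D] (Ext s)"]) (auto simp: inference_ok_def)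
qed

text \<open>\<open>AD\<close> is admissible even where its direct use would be maximal. Below
  \<open>EqI\<close> the premise of \<open>EqI\<close> is already the wanted conclusion; below
  \<open>EqE\<close> the \<open>AD\<close> moves to the major premise if the argument is
  \<open>t2\<close>, and to the minor premise otherwise. The induction ends at a conclusion of
  another rule or at an assumption, where \<open>AD\<close> is harmless.\<close>

lemma deduction_deriv_Ext:
  "deduction ar D \<Longrightarrow> inferences_ok D \<Longrightarrow> \<not> ends or_ex_elims D \<Longrightarrow> s \<in> args (concl D) \<Longrightarrow>
   opens D \<subseteq> {0} \<times> \<Gamma> \<Longrightarrow> deriv_prime ar \<Gamma> (Ext s)"
proof (induction D arbitrary: s)
  case (Assume u A)
  then show ?case by (intro deriv_Ext_direct[of ar "Assume u A"]) auto
next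
  case (Infer r Ds C)
  show ?case
  proof (cases "r \<in> {EqI, EqE}")
    case False
    with Infer.prems show ?thesis by (intro deriv_Ext_direct[of ar "Infer r Ds C"]) auto
  next
    case True
    from Infer.prems(1) show ?thesis
    proof cases
      case (eqI D t)
      with Infer.prems show ?thesis by (auto simp: inference_ok_def intro: derivI)
    next
      case (eqE D1 t1 t2 D2 x A)
      with Infer.prems(4) have "s \<in> args (subst x t2 A)" by simp
      then show ?thesis
      proof (cases rule: args_subst_cases[where ?t1.0 = t1])
        case 1
        with eqE Infer.prems show ?thesis
          by (intro Infer.IH[of D1]) (auto simp: inference_ok_def)
      next
        case 2
        with eqE Infer.prems show ?thesis
          by (intro Infer.IH[of D2]) (auto simp: inference_ok_def)
      qed
    qed (use True in auto)
  qed
qed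

lemma deriv_Ext: "deriv_prime ar \<Gamma> A \<Longrightarrow> s \<in> args A \<Longrightarrow> deriv_prime ar \<Gamma> (Ext s)"
  using deduction_deriv_Ext by (auto elim!: derivE)

text \<open>\<open>EqI\<close> is applied unless it would close a maximal existence segment. In that
  case the existence formula came by \<open>AD\<close> from an identity with equal sides, whose term
  can only be \<open>t\<close>, so the premise of that \<open>AD\<close> already is the wanted
  identity.\<close>

lemma deriv_Eq_refl:
  assumes "deriv_prime ar \<Gamma> (Ext (Tm t))"
  shows "deriv_prime ar \<Gamma> (Eq (Tm t) (Tm t))"
proof -
  obtain D where D: "deduction ar D" "concl D = Ext (Tm t)" "opens D \<subseteq> {0} \<times> \<Gamma>" "inferences_ok D"
    "\<not> ends or_ex_elims D"
    using assms by (rule derivE)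
  show ?thesis
  proof (cases "ends {AD} D \<and> (\<exists>t. concl (hd (prems D)) = Eq (Tm t) (Tm t))")
    case True
    with D(1) obtain D' where D': "D = Infer AD [D'] (concl D)" "deduction ar D'"
      "\<exists>t. concl D' = Eq (Tm t) (Tm t)"
      by (cases rule: deduction.cases) auto
    with D(1,2) have "concl D' = Eq (Tm t) (Tm t)"
      by (cases rule: deduction.cases) auto
    moreover have "inferences_ok (Infer AD [D'] (concl D))" "opens D' = opens D"
      using D(4) D'(1) by (metis, metis opens_simps(12))
    ultimately show ?thesis
      using D D' by (intro derivI[of _ D']) (auto simp: inference_ok_def ends_def)
  next
    case False
    with D show ?thesis
      by (intro derivI[of _ "Infer EqI [D] (Eq (Tm t) (Tm t))"])
        (auto simp: inference_ok_def intro: deduction.eqI)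
  qed
qed

lemma deriv_EqE:
  assumes "deriv_prime ar \<Gamma> (Eq (Tm t1) (Tm t2))" "deriv_prime ar \<Gamma> (subst x t1 A)"
    and "prime (subst x t2 A)"
  shows "deriv_prime ar \<Gamma> (subst x t2 A)"
proof (cases "t1 = t2")
  case False
  obtain D1 where D1: "deduction ar D1" "concl D1 = Eq (Tm t1) (Tm t2)" "opens D1 \<subseteq> {0} \<times> \<Gamma>"
    "inferences_ok D1" "\<not> ends or_ex_elims D1"
    using assms(1) by (rule derivE)
  obtain D2 where D2: "deduction ar D2" "concl D2 = subst x t1 A" "opens D2 \<subseteq> {0} \<times> \<Gamma>"
    "inferences_ok D2" "\<not> ends or_ex_elims D2"
    using assms(2) by (rule derivE)
  show ?thesis
  proof (cases "\<exists>t. subst x t2 A = Ext (Tm t)")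
    case True
    then obtain s where A: "A = Ext s" by (cases A) auto
    show ?thesis
    proof (cases "s = Var x")
      case True
      \<comment> \<open>The conclusion is the existence of \<open>t2\<close>, which follows from the
        major premise alone by \<open>AD\<close>; no \<open>EqE\<close> is used.\<close>
      with A deriv_Ext[OF assms(1)] show ?thesis by simp
    next
      case False
      with A assms(2) show ?thesis by (cases s) auto
    qed
  next
    case not_Ext: False
    \<comment> \<open>Only \<open>EqI\<close> introduces an identity, and its two sides would be
      equal, against \<open>t1 \<noteq> t2\<close>.\<close>
    have "\<not> ends intro_rules D1"
      using D1(1,2) False by (cases rule: deduction.cases) auto
    then have "\<not> ends (intro_rules \<union> or_ex_elims) D1"
      using D1(5) by (auto simp: ends_def)
    with D1 D2 False not_Ext assms(3) show ?thesis
      by (intro derivI[of _ "Infer EqE [D1, D2] (subst x t2 A)"])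
        (auto simp: inference_ok_def intro: deduction.eqE)
  qed
qed (use assms in simp)

lemma deriv_BotE: "neutral ar \<Gamma> Falsum \<Longrightarrow> formula ar A \<Longrightarrow> prime A \<Longrightarrow> deriv_prime ar \<Gamma> A"
  by (erule deriv_Infer1[where r = BotE]) (auto simp: inference_ok_def intro: deduction.intros)

section \<open>The model\<close>

text \<open>The inductively generated cover of Beth semantics: a finitely deep tree of case
  distinctions is replaced by a well-founded one that branches over all parameters at existential
  formulas. Asking for every \<open>a\<close>, not for a fresh one, keeps covers stable when the
  world grows; freshness enters only in \<open>covered_normal_deriv\<close>.\<close>

inductive covered ::
  "('p \<Rightarrow> nat) \<Rightarrow> (('c, 'p) fm set \<Rightarrow> bool) \<Rightarrow> ('c, 'p) fm set \<Rightarrow> bool" for ar S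
where
  base: "S \<Gamma> \<Longrightarrow> covered ar S \<Gamma>"
| disj: "\<lbrakk>neutral ar \<Gamma> (Disj A B); covered ar S (insert A \<Gamma>); covered ar S (insert B \<Gamma>)\<rbrakk>
     \<Longrightarrow> covered ar S \<Gamma>"
| ex: "\<lbrakk>neutral ar \<Gamma> (Exists x A);
      \<And>a. covered ar S (insert (Ext (Tm (Par a))) (insert (subst x (Par a) A) \<Gamma>))\<rbrakk>
     \<Longrightarrow> covered ar S \<Gamma>"

text \<open>Weakening of the world and change of the covered property in one induction. The leaves
  of the new cover extend \<Delta>, so facts forced at \<Delta> can be carried to them by
  monotonicity.\<close>

lemma covered_map:
  assumes "covered ar S \<Gamma>" "\<Gamma> \<subseteq> \<Delta>" "finite \<Delta>"
    and "\<And>\<Gamma>' \<Delta>'. S \<Gamma>' \<Longrightarrow> \<Gamma>' \<subseteq> \<Delta>' \<Longrightarrow> \<Delta> \<subseteq> \<Delta>' \<Longrightarrow> finite \<Delta>' \<Longrightarrow> S' \<Delta>'"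
  shows "covered ar S' \<Delta>"
  using assms
proof (induction arbitrary: \<Delta> rule: covered.induct)
  case (base \<Gamma>)
  then show ?case by (auto intro: covered.base)
next
  case (disj \<Gamma> A B)
  have "covered ar S' (insert A \<Delta>)" using disj.prems by (intro disj.IH(1)) auto
  moreover have "covered ar S' (insert B \<Delta>)" using disj.prems by (intro disj.IH(2)) auto
  moreover have "neutral ar \<Delta> (Disj A B)" using disj by (blast intro: deriv_mono)
  ultimately show ?case by (blast intro: covered.disj)
next
  case (ex \<Gamma> x A)
  have "covered ar S' (insert (Ext (Tm (Par a))) (insert (subst x (Par a) A) \<Delta>))" for a
    using ex.prems by (intro ex.IH) auto
  moreover have "neutral ar \<Delta> (Exists x A)" using ex by (blast intro: deriv_mono)
  ultimately show ?case by (blast intro: covered.ex)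
qed

lemma covered_deriv_mono:
  assumes "covered ar (\<lambda>\<Gamma>. deriv ar R \<Gamma> A) \<Gamma>" "\<Gamma> \<subseteq> \<Delta>" "finite \<Delta>"
  shows "covered ar (\<lambda>\<Gamma>. deriv ar R \<Gamma> A) \<Delta>"
  using assms by (rule covered_map) (auto elim: deriv_mono)

lemma covered_join: "covered ar (covered ar S) \<Gamma> \<Longrightarrow> covered ar S \<Gamma>"
  by (induction rule: covered.induct) (auto intro: covered.intros)

text \<open>A cover is read as a tree of \<open>OrE\<close> and \<open>ExE\<close> inferences that
  all conclude \<open>C\<close>. Their major premises are neutral, and a branch whose parameter is
  fresh for \<open>C\<close>, the existential formula and the world serves as the minor premise of
  \<open>ExE\<close>.\<close>

lemma covered_normal_deriv:
  "covered ar (\<lambda>\<Gamma>. normal_deriv ar \<Gamma> C) \<Gamma> \<Longrightarrow> finite \<Gamma> \<Longrightarrow> normal_deriv ar \<Gamma> C"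
proof (induction rule: covered.induct)
  case (disj \<Gamma> A B)
  then show ?case by (auto intro: normal_deriv_OrE)
next
  case (ex \<Gamma> x A)
  obtain a where "\<And>B. B \<in> insert C (insert (Exists x A) \<Gamma>) \<Longrightarrow> a \<notin> params B"
    using fresh_param[of "insert C (insert (Exists x A) \<Gamma>)"] ex.prems by blast
  then have "a \<notin> params C" "a \<notin> params (Exists x A)" "\<And>B. B \<in> \<Gamma> \<Longrightarrow> a \<notin> params B" by blast+
  moreover have "normal_deriv ar (insert (Ext (Tm (Par a))) (insert (subst x (Par a) A) \<Gamma>)) C"
    using ex by blast
  ultimately show ?case using ex.hyps(1) by (blast intro: normal_deriv_ExE)
qed

section \<open>Forcing, its monotonicity and its locality\<close>

primrec complexity :: "('c, 'p) fm \<Rightarrow> nat" where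
  "complexity (Rel P ss) = 0"
| "complexity (Ext s) = 0"
| "complexity (Eq s s') = 0"
| "complexity Falsum = 0"
| "complexity (Conj A B) = Suc (complexity A + complexity B)"
| "complexity (Disj A B) = Suc (complexity A + complexity B)"
| "complexity (Impl A B) = Suc (complexity A + complexity B)"
| "complexity (Exists x A) = Suc (complexity A)"
| "complexity (Forall x A) = Suc (complexity A)"

lemma complexity_subst [simp]: "complexity (subst x t A) = complexity A"
  by (induction A) auto

text \<open>Conjunctions, implications and universal formulas need no cover of their own, since they
  inherit locality from their parts. Quantifiers range over the terms whose existence is forced, as
  the premise \<open>Ext (Tm t)\<close> of \<open>AllE\<close> and \<open>ExI\<close> demands.
  \<open>Falsum\<close> is covered by neutral deductions so that \<open>BotE\<close> can be applied
  at each leaf.\<close>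

function forced :: "('p \<Rightarrow> nat) \<Rightarrow> ('c, 'p) fm \<Rightarrow> ('c, 'p) fm set \<Rightarrow> bool" where
  "forced ar (Rel P ss) = covered ar (\<lambda>\<Gamma>. deriv_prime ar \<Gamma> (Rel P ss))"
| "forced ar (Ext s) = covered ar (\<lambda>\<Gamma>. deriv_prime ar \<Gamma> (Ext s))"
| "forced ar (Eq s s') = covered ar (\<lambda>\<Gamma>. deriv_prime ar \<Gamma> (Eq s s'))"
| "forced ar Falsum = covered ar (\<lambda>\<Gamma>. neutral ar \<Gamma> Falsum)"
| "forced ar (Conj A B) = (\<lambda>\<Gamma>. forced ar A \<Gamma> \<and> forced ar B \<Gamma>)"
| "forced ar (Disj A B) = covered ar (\<lambda>\<Gamma>. forced ar A \<Gamma> \<or> forced ar B \<Gamma>)"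
| "forced ar (Impl A B) =
     (\<lambda>\<Gamma>. \<forall>\<Delta>. \<Gamma> \<subseteq> \<Delta> \<longrightarrow> finite \<Delta> \<longrightarrow> forced ar A \<Delta> \<longrightarrow> forced ar B \<Delta>)"
| "forced ar (Exists x A) =
     covered ar (\<lambda>\<Gamma>. \<exists>t. covered ar (\<lambda>\<Gamma>. deriv_prime ar \<Gamma> (Ext (Tm t))) \<Gamma> \<and>
        forced ar (subst x t A) \<Gamma>)"
| "forced ar (Forall x A) =
     (\<lambda>\<Gamma>. \<forall>\<Delta> t. \<Gamma> \<subseteq> \<Delta> \<longrightarrow> finite \<Delta> \<longrightarrow>
        covered ar (\<lambda>\<Gamma>. deriv_prime ar \<Gamma> (Ext (Tm t))) \<Delta> \<longrightarrow> forced ar (subst x t A) \<Delta>)"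
  by pat_completeness auto
termination by (relation "measure (\<lambda>(ar, A). complexity A)") auto

lemma forced_prime: "prime A \<Longrightarrow> forced ar A = covered ar (\<lambda>\<Gamma>. deriv_prime ar \<Gamma> A)"
  by (cases A) auto

lemma forced_mono: "forced ar A \<Gamma> \<Longrightarrow> \<Gamma> \<subseteq> \<Delta> \<Longrightarrow> finite \<Delta> \<Longrightarrow> forced ar A \<Delta>"
proof (induction ar A arbitrary: \<Gamma> \<Delta> rule: forced.induct)
  case (6 ar A B)
  from 6(3) have "covered ar (\<lambda>\<Gamma>. forced ar A \<Gamma> \<or> forced ar B \<Gamma>) \<Gamma>" by simp
  then have "covered ar (\<lambda>\<Gamma>. forced ar A \<Gamma> \<or> forced ar B \<Gamma>) \<Delta>"
    by (rule covered_map) (use 6 in blast)+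
  then show ?case by simp
next
  case (8 ar x A)
  let ?E = "\<lambda>t \<Gamma>. covered ar (\<lambda>\<Gamma>. deriv_prime ar \<Gamma> (Ext (Tm t))) \<Gamma>"
  have E: "?E t \<Delta>" if "?E t \<Gamma>" "\<Gamma> \<subseteq> \<Delta>" "finite \<Delta>" for t \<Gamma> \<Delta>
    using that by (rule covered_deriv_mono)
  from 8(2) have "covered ar (\<lambda>\<Gamma>. \<exists>t. ?E t \<Gamma> \<and> forced ar (subst x t A) \<Gamma>) \<Gamma>" by simp
  then have "covered ar (\<lambda>\<Gamma>. \<exists>t. ?E t \<Gamma> \<and> forced ar (subst x t A) \<Gamma>) \<Delta>"
    by (rule covered_map) (use 8 E in blast)+
  then show ?case by simp
next
  case (7 ar A B)
  then show ?case unfolding forced.simps by (meson subset_trans)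
next
  case (9 ar x A)
  then show ?case unfolding forced.simps by (meson subset_trans)
qed (auto intro: covered_deriv_mono)

text \<open>Locality of forcing. Where a clause is itself a cover, nested covers are joined; for
  implications and universal formulas the cover is moved to the larger world and the argument along
  with it to the leaves, where the induction hypothesis takes over.\<close>

lemma forced_covered: "covered ar (forced ar A) \<Gamma> \<Longrightarrow> finite \<Gamma> \<Longrightarrow> forced ar A \<Gamma>"
proof (induction ar A arbitrary: \<Gamma> rule: forced.induct)
  case (5 ar A B)
  from 5(3,4) have "covered ar (forced ar A) \<Gamma>" "covered ar (forced ar B) \<Gamma>"
    by (auto elim!: covered_map intro: forced_mono)
  with 5 show ?case by simp
next
  case (7 ar A B)
  show ?case
    unfolding forced.simps
  proof (intro HOL.allI HOL.impI)
    fix \<Delta>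
    assume \<Delta>: "\<Gamma> \<subseteq> \<Delta>" "finite \<Delta>" "forced ar A \<Delta>"
    from 7(3) \<Delta>(1,2) have "covered ar (forced ar B) \<Delta>"
    proof (rule covered_map)
      fix \<Gamma>' \<Delta>'
      assume "forced ar (Impl A B) \<Gamma>'" "\<Gamma>' \<subseteq> \<Delta>'" "\<Delta> \<subseteq> \<Delta>'" "finite \<Delta>'"
      moreover from this \<Delta>(3) have "forced ar A \<Delta>'" by (blast intro: forced_mono)
      ultimately show "forced ar B \<Delta>'" by simp
    qed
    with 7 \<Delta> show "forced ar B \<Delta>" by blast
  qed
next
  case (9 ar x A)
  let ?E = "\<lambda>t \<Gamma>. covered ar (\<lambda>\<Gamma>. deriv_prime ar \<Gamma> (Ext (Tm t))) \<Gamma>"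
  show ?case
    unfolding forced.simps
  proof (intro HOL.allI HOL.impI)
    fix \<Delta> t
    assume \<Delta>: "\<Gamma> \<subseteq> \<Delta>" "finite \<Delta>" "?E t \<Delta>"
    from 9(2) \<Delta>(1,2) have "covered ar (forced ar (subst x t A)) \<Delta>"
    proof (rule covered_map)
      fix \<Gamma>' \<Delta>'
      assume "forced ar (Forall x A) \<Gamma>'" "\<Gamma>' \<subseteq> \<Delta>'" "\<Delta> \<subseteq> \<Delta>'" "finite \<Delta>'"
      moreover from this \<Delta>(3) have "?E t \<Delta>'" using forced_mono[of ar "Ext (Tm t)" \<Delta> \<Delta>'] by simp
      ultimately show "forced ar (subst x t A) \<Delta>'" by simp
    qed
    with 9 \<Delta> show "forced ar (subst x t A) \<Delta>" by blast
  qed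
qed (simp_all add: covered_join)

section \<open>Reflection of neutral deductions and reification of forced formulas\<close>

lemma formula_simps [simp]:
  "formula ar (Conj A B) \<longleftrightarrow> formula ar A \<and> formula ar B"
  "formula ar (Disj A B) \<longleftrightarrow> formula ar A \<and> formula ar B"
  "formula ar (Impl A B) \<longleftrightarrow> formula ar A \<and> formula ar B"
  "formula ar (Ext (Tm t))"
  by (auto simp: formula_def)

lemma formula_subst:
  "formula ar (Exists x A) \<Longrightarrow> formula ar (subst x t A)"
  "formula ar (Forall x A) \<Longrightarrow> formula ar (subst x t A)"
  by (auto simp: formula_def)

lemma neutral_forced_prime:
  "prime A \<Longrightarrow> neutral ar \<Gamma> A \<Longrightarrow> forced ar A \<Gamma>"
  by (auto simp: forced_prime intro!: covered.base elim: deriv_mono)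

lemma forced_normal_deriv_prime:
  "prime A \<Longrightarrow> forced ar A \<Gamma> \<Longrightarrow> finite \<Gamma> \<Longrightarrow> normal_deriv ar \<Gamma> A"
  by (auto simp: forced_prime intro!: covered_normal_deriv elim!: covered_map deriv_mono)

text \<open>Both directions must be proved together, because implication is contravariant:
  reflecting it requires a normal deduction of a forced antecedent, and reifying it requires that
  the assumed antecedent, which is neutral, be forced. Induction on \<open>complexity\<close>
  reaches the instances \<open>subst x t B\<close>.\<close>

lemma neutral_forced_normal_deriv:
  fixes A :: "('c, 'p) fm"
  assumes "formula ar A" "finite \<Gamma>"
  shows "(neutral ar \<Gamma> A \<longrightarrow> forced ar A \<Gamma>) \<and> (forced ar A \<Gamma> \<longrightarrow> normal_deriv ar \<Gamma> A)"
  using assms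
proof (induction "complexity A" arbitrary: A \<Gamma> rule: less_induct)
  case less
  have reflect: "forced ar B \<Delta>"
    if "complexity B < complexity A" "formula ar B" "finite \<Delta>" "neutral ar \<Delta> B"
    for B :: "('c, 'p) fm" and \<Delta>
    using less.hyps[of B \<Delta>] that by blast
  have reify: "normal_deriv ar \<Delta> B"
    if "complexity B < complexity A" "formula ar B" "finite \<Delta>" "forced ar B \<Delta>"
    for B :: "('c, 'p) fm" and \<Delta>
    using less.hyps[of B \<Delta>] that by blast
  have hyp: "forced ar B (insert B \<Delta>)"
    if "complexity B < complexity A" "formula ar B" "finite \<Delta>"
    for B :: "('c, 'p) fm" and \<Delta>
    using that by (auto intro: reflect neutral_Assume)
  have hyp_Ext: "forced ar (Ext (Tm t)) (insert (Ext (Tm t)) \<Delta>)"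
    for t and \<Delta> :: "('c, 'p) fm set"
    by (intro neutral_forced_prime neutral_Assume) auto
  have prime_case: ?case if "prime A"
    using that less.prems neutral_forced_prime forced_normal_deriv_prime by blast
  show ?case
  proof (cases A)
    case Falsum
    have "normal_deriv ar \<Gamma> Falsum" if "covered ar (\<lambda>\<Gamma>. neutral ar \<Gamma> Falsum) \<Gamma>"
    proof (rule covered_normal_deriv)
      show "covered ar (\<lambda>\<Gamma>. normal_deriv ar \<Gamma> Falsum) \<Gamma>"
        using that by (rule covered_map) (auto intro: less.prems elim: deriv_mono)
    qed (rule less.prems)
    then show ?thesis using Falsum by (auto intro: covered.base)
  next
    case (Conj B C)
    with less.prems show ?thesis
      by (auto intro!: reflect reify normal_deriv_Conj dest: neutral_Conj)
  next
    case (Disj B C)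
    have "forced ar A \<Gamma>" if "neutral ar \<Gamma> A"
    proof -
      have "forced ar B (insert B \<Gamma>)" "forced ar C (insert C \<Gamma>)"
        using Disj less.prems by (auto intro: hyp)
      then show ?thesis using that Disj by (auto intro: covered.disj covered.base)
    qed
    moreover have "normal_deriv ar \<Gamma> A" if "forced ar A \<Gamma>"
    proof -
      from that Disj have "covered ar (\<lambda>\<Gamma>. forced ar B \<Gamma> \<or> forced ar C \<Gamma>) \<Gamma>" by simp
      then have "covered ar (\<lambda>\<Gamma>. normal_deriv ar \<Gamma> A) \<Gamma>"
      proof (rule covered_map)
        fix \<Gamma>' \<Delta>'
        assume "forced ar B \<Gamma>' \<or> forced ar C \<Gamma>'" "\<Gamma>' \<subseteq> \<Delta>'" "finite \<Delta>'"
        then have "forced ar B \<Delta>' \<or> forced ar C \<Delta>'" by (auto intro: forced_mono)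
        then have "normal_deriv ar \<Delta>' B \<or> normal_deriv ar \<Delta>' C"
          using Disj less.prems \<open>finite \<Delta>'\<close> reify[of B \<Delta>'] reify[of C \<Delta>'] by auto
        then show "normal_deriv ar \<Delta>' A"
          using Disj less.prems by (auto intro: normal_deriv_Disj1 normal_deriv_Disj2)
      qed (use less.prems in auto)
      then show ?thesis using less.prems(2) by (rule covered_normal_deriv)
    qed
    ultimately show ?thesis by blast
  next
    case (Impl B C)
    have "forced ar A \<Gamma>" if "neutral ar \<Gamma> A"
    proof -
      have "forced ar C \<Delta>" if "\<Gamma> \<subseteq> \<Delta>" "finite \<Delta>" "forced ar B \<Delta>" for \<Delta>
      proof -
        have "neutral ar \<Delta> (Impl B C)"
          using \<open>neutral ar \<Gamma> A\<close> Impl that(1) by (auto intro: deriv_mono)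
        moreover have "normal_deriv ar \<Delta> B" using Impl that less.prems by (auto intro: reify)
        ultimately show ?thesis
          using Impl less.prems that by (auto intro: reflect neutral_Impl)
      qed
      then show ?thesis using Impl by simp
    qed
    moreover have "normal_deriv ar \<Gamma> A" if "forced ar A \<Gamma>"
    proof -
      have "forced ar B (insert B \<Gamma>)" using Impl less.prems by (auto intro: hyp)
      then have "forced ar C (insert B \<Gamma>)" using that Impl less.prems by auto
      then have "normal_deriv ar (insert B \<Gamma>) C"
        using Impl less.prems by (intro reify) auto
      then show ?thesis using Impl less.prems by (simp add: normal_deriv_Impl)
    qed
    ultimately show ?thesis by blast
  next
    case (Exists x B)
    have "forced ar A \<Gamma>" if "neutral ar \<Gamma> A"
    proof -
      have "forced ar (Exists x B) (insert (Ext (Tm (Par a))) (insert (subst x (Par a) B) \<Gamma>))" for a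
      proof -
        let ?\<Delta> = "insert (Ext (Tm (Par a))) (insert (subst x (Par a) B) \<Gamma>)"
        have "forced ar (subst x (Par a) B) ?\<Delta>"
          using Exists less.prems formula_subst(1)
          by (intro reflect neutral_Assume) auto
        then show ?thesis using hyp_Ext[of "Par a"] by (auto intro: covered.base)
      qed
      then show ?thesis using that Exists by (auto intro: covered.ex)
    qed
    moreover have "normal_deriv ar \<Gamma> A" if "forced ar A \<Gamma>"
    proof -
      from that Exists
      have "covered ar (\<lambda>\<Gamma>. \<exists>t. forced ar (Ext (Tm t)) \<Gamma> \<and> forced ar (subst x t B) \<Gamma>) \<Gamma>" by simp
      then have "covered ar (\<lambda>\<Gamma>. normal_deriv ar \<Gamma> A) \<Gamma>"
      proof (rule covered_map)
        fix \<Gamma>' \<Delta>'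
        assume "\<exists>t. forced ar (Ext (Tm t)) \<Gamma>' \<and> forced ar (subst x t B) \<Gamma>'"
          and \<Delta>': "\<Gamma>' \<subseteq> \<Delta>'" "finite \<Delta>'"
        then obtain t where "forced ar (Ext (Tm t)) \<Delta>'" "forced ar (subst x t B) \<Delta>'"
          using forced_mono by blast
        moreover from this have "normal_deriv ar \<Delta>' (Ext (Tm t))"
          using \<Delta>' by (intro forced_normal_deriv_prime) auto
        moreover have "normal_deriv ar \<Delta>' (subst x t B)"
          using Exists less.prems \<Delta>' calculation formula_subst(1) by (intro reify) auto
        ultimately show "normal_deriv ar \<Delta>' A"
          using Exists by (auto intro: normal_deriv_Exists)
      qed (use less.prems in auto)
      then show ?thesis using less.prems(2) by (rule covered_normal_deriv)
    qed
    ultimately show ?thesis by blast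
  next
    case (Forall x B)
    have "forced ar A \<Gamma>" if "neutral ar \<Gamma> A"
    proof -
      have "forced ar (subst x t B) \<Delta>"
        if "\<Gamma> \<subseteq> \<Delta>" "finite \<Delta>" "forced ar (Ext (Tm t)) \<Delta>" for \<Delta> t
      proof -
        have "neutral ar \<Delta> (Forall x B)"
          using \<open>neutral ar \<Gamma> A\<close> Forall that(1) by (auto intro: deriv_mono)
        moreover have "normal_deriv ar \<Delta> (Ext (Tm t))"
          using that by (intro forced_normal_deriv_prime) auto
        ultimately show ?thesis
          using Forall less.prems that formula_subst(2) by (intro reflect neutral_Forall) auto
      qed
      then show ?thesis using Forall by simp
    qed
    moreover have "normal_deriv ar \<Gamma> A" if "forced ar A \<Gamma>"
    proof -
      obtain a where a: "\<And>B. B \<in> insert A \<Gamma> \<Longrightarrow> a \<notin> params B"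
        using fresh_param[of "insert A \<Gamma>"] less.prems by blast
      let ?\<Delta> = "insert (Ext (Tm (Par a))) \<Gamma>"
      have "forced ar (subst x (Par a) B) ?\<Delta>"
        using that Forall less.prems hyp_Ext[of "Par a" \<Gamma>] by auto
      then have "normal_deriv ar ?\<Delta> (subst x (Par a) B)"
        using Forall less.prems formula_subst(2) by (intro reify) auto
      then show ?thesis
        using a Forall by (auto intro!: normal_deriv_Forall[of ar a])
    qed
    ultimately show ?thesis by blast
  qed (rule prime_case, simp)+
qed

section \<open>Soundness\<close>

text \<open>Parameters are interpreted by terms: soundness of the rules with an eigenparameter needs
  its instances at all existing terms. Nothing can be captured, as terms contain no bound
  variables.\<close>

primrec psubst_trm :: "(nat \<Rightarrow> 'c trm) \<Rightarrow> 'c trm \<Rightarrow> 'c trm" where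
  "psubst_trm \<theta> (Par a) = \<theta> a"
| "psubst_trm \<theta> (Con c) = Con c"

primrec psubst_arg :: "(nat \<Rightarrow> 'c trm) \<Rightarrow> 'c arg \<Rightarrow> 'c arg" where
  "psubst_arg \<theta> (Var x) = Var x"
| "psubst_arg \<theta> (Tm t) = Tm (psubst_trm \<theta> t)"

primrec psubst :: "(nat \<Rightarrow> 'c trm) \<Rightarrow> ('c, 'p) fm \<Rightarrow> ('c, 'p) fm" where
  "psubst \<theta> (Rel P ss) = Rel P (map (psubst_arg \<theta>) ss)"
| "psubst \<theta> (Ext s) = Ext (psubst_arg \<theta> s)"
| "psubst \<theta> (Eq s s') = Eq (psubst_arg \<theta> s) (psubst_arg \<theta> s')"
| "psubst \<theta> Falsum = Falsum"
| "psubst \<theta> (Conj A B) = Conj (psubst \<theta> A) (psubst \<theta> B)"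
| "psubst \<theta> (Disj A B) = Disj (psubst \<theta> A) (psubst \<theta> B)"
| "psubst \<theta> (Impl A B) = Impl (psubst \<theta> A) (psubst \<theta> B)"
| "psubst \<theta> (Exists x A) = Exists x (psubst \<theta> A)"
| "psubst \<theta> (Forall x A) = Forall x (psubst \<theta> A)"

lemma psubst_arg_subst:
  "psubst_arg \<theta> (subst_arg x t s) = subst_arg x (psubst_trm \<theta> t) (psubst_arg \<theta> s)"
  by (cases s) auto

lemma psubst_subst: "psubst \<theta> (subst x t A) = subst x (psubst_trm \<theta> t) (psubst \<theta> A)"
  by (induction A) (auto simp: psubst_arg_subst)

lemma psubst_arg_cong: "(\<And>a. a \<in> params_arg s \<Longrightarrow> \<theta> a = \<theta>' a) \<Longrightarrow> psubst_arg \<theta> s = psubst_arg \<theta>' s"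
proof (cases s)
  case (Tm t)
  then show "(\<And>a. a \<in> params_arg s \<Longrightarrow> \<theta> a = \<theta>' a) \<Longrightarrow> ?thesis" by (cases t) auto
qed simp

lemma psubst_cong: "(\<And>a. a \<in> params A \<Longrightarrow> \<theta> a = \<theta>' a) \<Longrightarrow> psubst \<theta> A = psubst \<theta>' A"
  by (induction A) (auto intro: psubst_arg_cong)

lemma psubst_fresh: "a \<notin> params A \<Longrightarrow> psubst (\<theta>(a := t)) A = psubst \<theta> A"
  by (rule psubst_cong) auto

lemma psubst_arg_Par: "psubst_arg Par s = s"
  \<comment> \<open>The inner \<open>case\<close> expression names the term under \<open>Tm\<close>.
    At \<open>Var\<close> it is undefined, but that goal is closed by then.\<close>
  by (cases s; simp; cases "case s of Tm t \<Rightarrow> t"; simp)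

lemma psubst_Par: "psubst Par A = A"
  by (induction A) (auto simp: psubst_arg_Par map_idI)

lemma vars_psubst_arg: "vars_arg (psubst_arg \<theta> s) = vars_arg s"
  by (cases s) auto

lemma formula_psubst: "formula ar A \<Longrightarrow> formula ar (psubst \<theta> A)"
proof -
  have "free_vars (psubst \<theta> A) = free_vars A" "arity_ok ar (psubst \<theta> A) = arity_ok ar A"
    by (induction A) (auto simp: vars_psubst_arg)
  then show "formula ar A \<Longrightarrow> formula ar (psubst \<theta> A)" by (simp add: formula_def)
qed

lemma prime_psubst: "prime (psubst \<theta> A) = prime A"
  by (cases A) auto

lemma prime_subst: "prime (subst x t A) = prime A"
  by (cases A) auto

lemma forced_map:
  assumes "forced ar A \<Gamma>" "finite \<Gamma>" "prime A" "prime B"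
    and "\<And>\<Delta>. deriv_prime ar \<Delta> A \<Longrightarrow> deriv_prime ar \<Delta> B"
  shows "forced ar B \<Gamma>"
  using assms by (auto simp: forced_prime elim!: covered_map intro: deriv_mono)

text \<open>The premises come with two different covers. The minor premise is carried to each leaf
  of the cover of the major one and covered again there; \<open>forced_covered\<close> then returns
  to \<Gamma>.\<close>

lemma forced_EqE:
  assumes "forced ar (Eq (Tm t1) (Tm t2)) \<Gamma>" "forced ar (subst x t1 A) \<Gamma>" "finite \<Gamma>" "prime A"
  shows "forced ar (subst x t2 A) \<Gamma>"
proof -
  from assms(1) have "covered ar (\<lambda>\<Gamma>. deriv_prime ar \<Gamma> (Eq (Tm t1) (Tm t2))) \<Gamma>" by simp
  then have "covered ar (forced ar (subst x t2 A)) \<Gamma>"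
  proof (rule covered_map)
    fix \<Gamma>' \<Delta>
    assume *: "deriv_prime ar \<Gamma>' (Eq (Tm t1) (Tm t2))" "\<Gamma>' \<subseteq> \<Delta>" "\<Gamma> \<subseteq> \<Delta>" "finite \<Delta>"
    then have "forced ar (subst x t1 A) \<Delta>" using assms(2) by (auto intro: forced_mono)
    then have "covered ar (\<lambda>\<Gamma>. deriv_prime ar \<Gamma> (subst x t1 A)) \<Delta>"
      using assms(4) by (simp add: forced_prime prime_subst)
    then have "covered ar (\<lambda>\<Gamma>. deriv_prime ar \<Gamma> (subst x t2 A)) \<Delta>"
      by (rule covered_map)
        (use * assms(4) in \<open>auto simp: prime_subst intro!: deriv_EqE[of ar _ t1 t2] intro: deriv_mono\<close>)
    then show "forced ar (subst x t2 A) \<Delta>"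
      using assms(4) by (simp add: forced_prime prime_subst)
  qed (use assms(3) in auto)
  then show ?thesis using assms(3) by (rule forced_covered)
qed

text \<open>The induction is over all worlds and all interpretations \<theta>: discharged
  assumptions enlarge the world, and an eigenparameter is reinterpreted. For \<open>OrE\<close> and
  \<open>ExE\<close> the conclusion is forced at the leaves of the cover given by the major premise,
  hence by locality at \<Gamma>.\<close>

lemma deduction_forced:
  assumes "deduction ar D" "finite \<Gamma>" "\<And>u B. (u, B) \<in> opens D \<Longrightarrow> forced ar (psubst \<theta> B) \<Gamma>"
  shows "forced ar (psubst \<theta> (concl D)) \<Gamma>"
  using assms
proof (induction arbitrary: \<Gamma> \<theta> rule: deduction.induct)
  case (assm A u)
  then show ?case by simp
next
  case (impI D B A u)
  have "forced ar (psubst \<theta> B) \<Delta>"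
    if "\<Gamma> \<subseteq> \<Delta>" "finite \<Delta>" "forced ar (psubst \<theta> A) \<Delta>" for \<Delta>
    using impI.IH[of \<Delta> \<theta>] impI.prems impI.hyps(2) that
    by (metis DiffI forced_mono old.prod.inject opens_simps(3) singletonD)
  then show ?case by simp
next
  case (impE D1 A B D2)
  then have "forced ar (psubst \<theta> (Impl A B)) \<Gamma>" "forced ar (psubst \<theta> A) \<Gamma>" by force+
  with impE.prems show ?case by simp
next
  case (orI1 D A B)
  then show ?case by (auto intro: covered.base)
next
  case (orI2 D B A)
  then show ?case by (auto intro: covered.base)
next
  case (orE D A B D1 C D2 u)
  note opens = opens_OrE[OF orE.hyps(2)]
  have "forced ar (psubst \<theta> (Disj A B)) \<Gamma>"
    using orE.IH(1)[OF orE.prems(1)] orE.hyps(2) orE.prems(2) by (auto simp: opens)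
  then have "covered ar (\<lambda>\<Gamma>. forced ar (psubst \<theta> A) \<Gamma> \<or> forced ar (psubst \<theta> B) \<Gamma>) \<Gamma>" by simp
  then have "covered ar (forced ar (psubst \<theta> C)) \<Gamma>"
  proof (rule covered_map)
    fix \<Gamma>' \<Delta>
    assume *: "forced ar (psubst \<theta> A) \<Gamma>' \<or> forced ar (psubst \<theta> B) \<Gamma>'"
      "\<Gamma>' \<subseteq> \<Delta>" "\<Gamma> \<subseteq> \<Delta>" "finite \<Delta>"
    then have prems: "forced ar (psubst \<theta> F) \<Delta>"
      if "(v, F) \<in> opens (Infer (OrE u) [D, D1, D2] C)" for v F
      using orE.prems(2) that forced_mono by blast
    from * consider "forced ar (psubst \<theta> A) \<Delta>" | "forced ar (psubst \<theta> B) \<Delta>"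
      using forced_mono by blast
    then show "forced ar (psubst \<theta> C) \<Delta>"
    proof cases
      case 1
      then show ?thesis
        using orE.IH(2)[OF *(4), of \<theta>] orE.hyps prems
        by (metis (no_types, lifting) DiffI UnI1 UnI2 old.prod.inject opens singletonD)
    next
      case 2
      then show ?thesis
        using orE.IH(3)[OF *(4), of \<theta>] orE.hyps prems
        by (metis (no_types, lifting) DiffI UnI1 UnI2 old.prod.inject opens singletonD)
    qed
  qed (use orE.prems in auto)
  then show ?case using orE.prems(1) forced_covered by fastforce
next
  case (botE D B)
  then have "forced ar (psubst \<theta> Falsum) \<Gamma>" by force
  then have "covered ar (\<lambda>\<Gamma>. neutral ar \<Gamma> Falsum) \<Gamma>" by simp
  \<comment> \<open>Since \<open>B\<close> is prime, falsity has to be exploited only leaf by leaf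
    through \<open>deriv_BotE\<close>.\<close>
  then have "covered ar (\<lambda>\<Gamma>. deriv_prime ar \<Gamma> (psubst \<theta> B)) \<Gamma>"
    by (rule covered_map)
      (use botE in \<open>auto intro: deriv_BotE deriv_mono formula_psubst simp: prime_psubst\<close>)
  then show ?case using botE by (simp add: forced_prime prime_psubst)
next
  case (allI D x a A u)
  have "forced ar (subst x t (psubst \<theta> A)) \<Delta>"
    if "\<Gamma> \<subseteq> \<Delta>" "finite \<Delta>" "forced ar (Ext (Tm t)) \<Delta>" for \<Delta> t
  proof -
    \<comment> \<open>The eigenparameter now denotes \<open>t\<close>. By its freshness the
      remaining open assumptions and \<open>A\<close> keep their interpretation, while the premise
      becomes the instance of \<open>A\<close> at \<open>t\<close>.\<close>
    let ?\<theta> = "\<theta>(a := t)"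
    have "forced ar (psubst ?\<theta> B) \<Delta>" if "(v, B) \<in> opens D" for v B
    proof (cases "(v, B) = (u, Ext (Tm (Par a)))")
      case True
      with \<open>forced ar (Ext (Tm t)) \<Delta>\<close> show ?thesis by simp
    next
      case False
      with that allI have "a \<notin> params B" "forced ar (psubst \<theta> B) \<Gamma>" by auto
      with \<open>\<Gamma> \<subseteq> \<Delta>\<close> \<open>finite \<Delta>\<close> show ?thesis by (simp add: psubst_fresh forced_mono)
    qed
    then have "forced ar (psubst ?\<theta> (concl D)) \<Delta>" using allI.IH \<open>finite \<Delta>\<close> by blast
    then show ?thesis using allI by (simp add: psubst_subst psubst_fresh)
  qed
  then show ?case by simp
next
  case (allE D1 x A D2 t)
  then have "forced ar (psubst \<theta> (Forall x A)) \<Gamma>" "forced ar (psubst \<theta> (Ext (Tm t))) \<Gamma>" by force+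
  with allE.prems show ?case by (simp add: psubst_subst)
next
  case (exI D1 x t A D2)
  then have "forced ar (psubst \<theta> (subst x t A)) \<Gamma>" "forced ar (psubst \<theta> (Ext (Tm t))) \<Gamma>" by force+
  then show ?case by (auto simp: psubst_subst intro!: covered.base)
next
  case (exE D1 x A D2 C a u)
  note opens = opens_ExE[OF exE.hyps(2)]
  have "forced ar (psubst \<theta> (Exists x A)) \<Gamma>"
    using exE.IH(1)[OF exE.prems(1)] exE.hyps(2) exE.prems(2) by (auto simp: opens)
  then have "covered ar
      (\<lambda>\<Gamma>. \<exists>t. forced ar (Ext (Tm t)) \<Gamma> \<and> forced ar (subst x t (psubst \<theta> A)) \<Gamma>) \<Gamma>"
    by simp
  then have "covered ar (forced ar (psubst \<theta> C)) \<Gamma>"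
  proof (rule covered_map)
    fix \<Gamma>' \<Delta>
    assume "\<exists>t. forced ar (Ext (Tm t)) \<Gamma>' \<and> forced ar (subst x t (psubst \<theta> A)) \<Gamma>'"
      and \<Delta>: "\<Gamma>' \<subseteq> \<Delta>" "\<Gamma> \<subseteq> \<Delta>" "finite \<Delta>"
    then obtain t where t: "forced ar (Ext (Tm t)) \<Delta>" "forced ar (subst x t (psubst \<theta> A)) \<Delta>"
      using forced_mono by blast
    let ?\<theta> = "\<theta>(a := t)"
    have "forced ar (psubst ?\<theta> B) \<Delta>" if "(v, B) \<in> opens D2" for v B
    proof (cases "(v, B) \<in> {(u, subst x (Par a) A), (u, Ext (Tm (Par a)))}")
      case True
      with t exE.hyps show ?thesis by (auto simp: psubst_subst psubst_fresh)
    next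
      case False
      with that exE.hyps have "a \<notin> params B" by auto
      moreover have "forced ar (psubst \<theta> B) \<Gamma>"
        using that False by (intro exE.prems(2)[of v]) (auto simp: opens)
      ultimately show ?thesis using \<Delta> by (simp add: psubst_fresh forced_mono)
    qed
    then have "forced ar (psubst ?\<theta> (concl D2)) \<Delta>" using exE.IH(2) \<Delta>(3) by blast
    then show "forced ar (psubst \<theta> C) \<Delta>" using exE.hyps by (simp add: psubst_fresh)
  qed (use exE.prems in auto)
  then show ?case using exE.prems(1) forced_covered by fastforce
next
  case (eqI D t)
  then have "forced ar (psubst \<theta> (Ext (Tm t))) \<Gamma>" by force
  then have "forced ar (psubst \<theta> (Eq (Tm t) (Tm t))) \<Gamma>"
    by (rule forced_map) (use eqI in \<open>auto intro: deriv_Eq_refl\<close>)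
  then show ?case by simp
next
  case (eqE D1 t1 t2 D2 x A)
  then have "forced ar (psubst \<theta> (Eq (Tm t1) (Tm t2))) \<Gamma>" "forced ar (psubst \<theta> (subst x t1 A)) \<Gamma>"
    by force+
  with eqE show ?case
    using forced_EqE[of ar "psubst_trm \<theta> t1" "psubst_trm \<theta> t2" \<Gamma> x "psubst \<theta> A"]
    by (simp add: psubst_subst prime_subst prime_psubst)
next
  case (ad_rel D P ss s)
  then have "forced ar (psubst \<theta> (Rel P ss)) \<Gamma>" by force
  then have "forced ar (psubst \<theta> (Ext s)) \<Gamma>"
    by (rule forced_map) (use ad_rel in \<open>auto intro: deriv_Ext\<close>)
  then show ?case by simp
next
  case (ad_eq D s1 s2 s)
  then have "forced ar (psubst \<theta> (Eq s1 s2)) \<Gamma>" by force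
  then have "forced ar (psubst \<theta> (Ext s)) \<Gamma>"
    by (rule forced_map) (use ad_eq in \<open>auto intro: deriv_Ext\<close>)
  then show ?case by simp
qed force+

theorem theorem1:
  fixes ar :: "'p \<Rightarrow> nat"
    and \<Gamma> :: "('c, 'p) fm set"
    and A :: "('c, 'p) fm"
    and D :: "('c, 'p) ded"
  assumes "deduction_from ar \<Gamma> A D"
  shows "\<exists>D'. deduction_from ar \<Gamma> A D' \<and> normal D'"
proof -
  \<comment> \<open>\<Gamma> may be infinite, whereas worlds are finite, so the evaluation takes
    place at the assumptions actually open in \<open>D\<close>.\<close>
  let ?\<Delta> = "snd ` opens D"
  have D: "deduction ar D" "concl D = A" "?\<Delta> \<subseteq> \<Gamma>"
    using assms by (auto simp: deduction_from_def)
  have fin: "finite ?\<Delta>" by (simp add: finite_opens)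
  have "forced ar B ?\<Delta>" if "(u, B) \<in> opens D" for u B
  proof -
    have "formula ar B" using D(1) that by (rule opens_formula)
    moreover from this have "neutral ar ?\<Delta> B" using that by (force intro: neutral_Assume)
    ultimately show ?thesis using neutral_forced_normal_deriv fin by blast
  qed
  \<comment> \<open>\<open>Par\<close> is the identity interpretation of the parameters.\<close>
  then have "forced ar A ?\<Delta>"
    using deduction_forced[OF D(1) fin, of Par] D(2) by (simp add: psubst_Par)
  then have "normal_deriv ar ?\<Delta> A"
    using neutral_forced_normal_deriv fin deduction_formula[OF D(1)] D(2) by blast
  then obtain D' where "deduction ar D'" "concl D' = A" "opens D' \<subseteq> {0} \<times> ?\<Delta>" "inferences_ok D'"
    by (rule derivE)
  moreover from this(3) have "snd ` opens D' \<subseteq> \<Gamma>" using D(3) by (fastforce dest: subsetD)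
  ultimately show ?thesis
    unfolding deduction_from_def using normal_if_inferences_ok by blast
qed

end
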